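(* Let $B$ be a compact subset of the subcritical region. There is a constant $C$ depending only on $B$ such that for every $\beta\in B$ and every $n\ge2$, if $E_n$ is the number of edges of a random graph on $n$ vertices following the ERGM with parameter $\beta$, $N=n(n-1)/2$, $\widetilde p=\mathbb{E}(E_n)/N$, and $p=p_\beta$ is the unique solution in $(0,1)$ of $\varphi_\beta(a)=a$, then $$|p-\widetilde p|\le Cn^{-1}.$$
   Context: Fix an integer $m\ge1$ and fixed simple graphs $H_1,\dots,H_m$ without isolated vertices, where $H_1$ is a single edge and $H_2,\dots,H_m$ each have at least two edges. Let $e_l$ be the number of edges of $H_l$. Constants may depend on these fixed graphs. $\operatorname{Hom}(H,G)$ is the number of injective maps from the vertex set of $H$ to that of $G$ mapping every edge of $H$ to an edge of $G$; $t(H,G)=\operatorname{Hom}(H,G)/n^{|\mathcal V(H)|}$ for $G$ a simple graph on $n$ vertices. For $\beta=(\beta_1,\dots,\beta_m)$ with $\beta_1\in\mathbb{R}$, $\beta_2,\dots,\beta_m>0$, the exponential random graph model (ERGM) is the probability measure on simple graphs $G$ on vertex set $\{1,\dots,n\}$ $$p_\beta(G)=\frac1{Z(\beta)}\exp\Bigl\{n^2\sum_{i=1}^m\beta_i t(H_i,G)\Bigr\}.$$ Let $\Phi_\beta(a)=\sum_{i=1}^m\beta_ie_ia^{e_i-1}$ and $\varphi_\beta(a)=\frac{\exp(2\Phi_\beta(a))}{1+\exp(2\Phi_\beta(a))}$. The subcritical region is the set of $\beta\in\mathbb{R}\times(0,\infty)^{m-1}$ such that $\varphi_\beta(a)=a$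 has a unique solution $p=p_\beta$ in $(0,1)$ and $\varphi_\beta'(p)<1$. *)

theory Defs
  imports "HOL-Probability.Probability"
begin

datatype 'v sgraph = SGraph (verts: "'v set") (edges: "'v set set")

definition simple_graph :: "'v sgraph \<Rightarrow> bool" where
  "simple_graph G \<longleftrightarrow>
     finite (verts G) \<and> (\<forall>e\<in>edges G. e \<subseteq> verts G \<and> card e = 2)"

definition no_isolated_vertices :: "'v sgraph \<Rightarrow> bool" where
  "no_isolated_vertices G \<longleftrightarrow> (\<forall>v\<in>verts G. \<exists>e\<in>edges G. v \<in> e)"

definition is_single_edge :: "'v sgraph \<Rightarrow> bool" where
  "is_single_edge G \<longleftrightarrow> (\<exists>u v. u \<noteq> v \<and> G = SGraph {u, v} {{u, v}})"

definition num_edges :: "'v sgraph \<Rightarrow> nat" where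
  "num_edges G = card (edges G)"

definition graphs_on :: "nat \<Rightarrow> nat sgraph set" where
  "graphs_on n = {G. simple_graph G \<and> verts G = {1..n}}"

text \<open>Only injective maps are counted. The maps are taken extensional on the vertex set
  of \<open>H\<close>, so that the set has the intended cardinality.\<close>

definition Hom :: "'v sgraph \<Rightarrow> 'w sgraph \<Rightarrow> nat" where
  "Hom H G = card {f \<in> verts H \<rightarrow>\<^sub>E verts G.
                     inj_on f (verts H) \<and> (\<forall>e\<in>edges H. f ` e \<in> edges G)}"

definition hom_density :: "'v sgraph \<Rightarrow> 'w sgraph \<Rightarrow> real" where
  "hom_density H G = real (Hom H G) / real (card (verts G)) ^ card (verts H)"

text \<open>A family \<open>H\<^sub>1, \<dots>, H\<^sub>m\<close> is indexed by a finite type \<open>'m\<close> with \<open>CARD('m) = m\<close>,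
  and \<open>\<beta>\<close> ranges over \<open>\<real>\<^sup>m\<close>.\<close>

definition ergm_weight :: "('m::finite \<Rightarrow> 'v sgraph) \<Rightarrow> nat \<Rightarrow> real ^ 'm \<Rightarrow> nat sgraph \<Rightarrow> real" where
  "ergm_weight H n \<beta> G = exp ((real n)\<^sup>2 * (\<Sum>i\<in>UNIV. \<beta> $ i * hom_density (H i) G))"

definition ergm_Z :: "('m::finite \<Rightarrow> 'v sgraph) \<Rightarrow> nat \<Rightarrow> real ^ 'm \<Rightarrow> real" where
  "ergm_Z H n \<beta> = (\<Sum>G\<in>graphs_on n. ergm_weight H n \<beta> G)"

definition ergm :: "('m::finite \<Rightarrow> 'v sgraph) \<Rightarrow> nat \<Rightarrow> real ^ 'm \<Rightarrow> nat sgraph pmf" where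
  "ergm H n \<beta> =
     embed_pmf (\<lambda>G. if G \<in> graphs_on n then ergm_weight H n \<beta> G / ergm_Z H n \<beta> else 0)"

lemma finite_graphs_on: "finite (graphs_on n)"
proof (rule finite_subset)
  show "graphs_on n \<subseteq> SGraph {1..n} ` Pow (Pow {1..n})"
  proof
    fix G assume "G \<in> graphs_on n"
    then have "G = SGraph {1..n} (edges G)" "edges G \<in> Pow (Pow {1..n})"
      by (auto simp: graphs_on_def simple_graph_def intro: sgraph.expand)
    then show "G \<in> SGraph {1..n} ` Pow (Pow {1..n})" by (rule image_eqI)
  qed
qed simp

lemma graphs_on_nonempty: "graphs_on n \<noteq> {}"
proof -
  have "SGraph {1..n} {} \<in> graphs_on n" by (simp add: graphs_on_def simple_graph_def)
  then show ?thesis by blast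
qed

lemma ergm_Z_pos: "ergm_Z H n \<beta> > 0"
  unfolding ergm_Z_def
  by (rule sum_pos) (auto simp: finite_graphs_on graphs_on_nonempty ergm_weight_def)

lemma pmf_ergm:
  "pmf (ergm H n \<beta>) G =
     (if G \<in> graphs_on n then ergm_weight H n \<beta> G / ergm_Z H n \<beta> else 0)"
proof -
  let ?f = "\<lambda>G. if G \<in> graphs_on n then ergm_weight H n \<beta> G / ergm_Z H n \<beta> else 0"
  have nonneg: "0 \<le> ?f G" for G
    using ergm_Z_pos[of H n \<beta>] by (simp add: ergm_weight_def)
  have "(\<integral>\<^sup>+G. ennreal (?f G) \<partial>count_space UNIV) = (\<Sum>G\<in>graphs_on n. ennreal (?f G))"
    by (rule nn_integral_count_space'[OF finite_graphs_on]) auto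
  also have "\<dots> = ennreal (\<Sum>G\<in>graphs_on n. ?f G)"
    by (rule sum_ennreal) (rule nonneg)
  also have "(\<Sum>G\<in>graphs_on n. ?f G) = (\<Sum>G\<in>graphs_on n. ergm_weight H n \<beta> G) / ergm_Z H n \<beta>"
    by (simp add: sum_divide_distrib)
  also have "\<dots> = 1" using ergm_Z_pos[of H n \<beta>] by (simp add: ergm_Z_def)
  finally have one: "(\<integral>\<^sup>+G. ennreal (?f G) \<partial>count_space UNIV) = 1" by simp
  show ?thesis unfolding ergm_def by (rule pmf_embed_pmf[OF nonneg one])
qed

definition ergm_Phi :: "('m::finite \<Rightarrow> 'v sgraph) \<Rightarrow> real ^ 'm \<Rightarrow> real \<Rightarrow> real" where
  "ergm_Phi H \<beta> a = (\<Sum>i\<in>UNIV. \<beta> $ i * real (num_edges (H i)) * a ^ (num_edges (H i) - 1))"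

definition ergm_phi :: "('m::finite \<Rightarrow> 'v sgraph) \<Rightarrow> real ^ 'm \<Rightarrow> real \<Rightarrow> real" where
  "ergm_phi H \<beta> a = exp (2 * ergm_Phi H \<beta> a) / (1 + exp (2 * ergm_Phi H \<beta> a))"

definition ergm_p :: "('m::finite \<Rightarrow> 'v sgraph) \<Rightarrow> real ^ 'm \<Rightarrow> real" where
  "ergm_p H \<beta> = (THE a. a \<in> {0<..<1} \<and> ergm_phi H \<beta> a = a)"

text \<open>The argument \<open>i\<^sub>1\<close> is the index of the single edge, whose parameter is not
  restricted to be positive.\<close>

definition subcritical :: "('m::finite \<Rightarrow> 'v sgraph) \<Rightarrow> 'm \<Rightarrow> (real ^ 'm) set" where
  "subcritical H i\<^sub>1 =
     {\<beta>. (\<forall>i. i \<noteq> i\<^sub>1 \<longrightarrow> \<beta> $ i > 0) \<and>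
         (\<exists>!a. a \<in> {0<..<1} \<and> ergm_phi H \<beta> a = a) \<and>
         deriv (ergm_phi H \<beta>) (ergm_p H \<beta>) < 1}"

end

(* For a fixed edge e let field e be the change of the Hamiltonian when e is added, so that e is
   present with conditional probability logistic (field e). Hence E[X_e g] = E[logistic (field e) g^e],
   where g^e is g with e added, and one edge changes field j only by O(1/n).

   First step: if all fields are at most t with probability 1 - exp(-cn), then replacing the edges
   one by one in E[X_S exp(l field e)] gives a differential inequality for the moment generating
   function of field e, and field e is at most 2 Phi(logistic t) + gamma with probability
   1 - exp(-c'n), for any fixed gamma > 0; the signs of beta_2, ..., beta_m enter here. Starting
   from the trivial bound and iterating finitely often from above and from below, the
   uniqueness of the fixed point confines all fields to a small neighbourhood of t = 2 Phi(p).

   Second step: put h_e = field e - t. Expanding E[h_e (X_S - p^|S|)] to first order yields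
   E[h_e^2] <= (phi'(p) + small) max_j E[h_j^2] + O(1/n), so max_j E[h_j^2] = O(1/n). The same
   expansion without the factor h_e yields
   max_e |E X_e - p| <= phi'(p) max_e |E X_e - p| + O(1/n). Both estimates close as phi'(p) < 1.

   All constants can be chosen locally uniformly in beta, and B is compact. *)

theory Submission
  imports Defs
begin

section \<open>Gibbs measures on finite power sets\<close>

text \<open>The tails must be exponentially small because the Chernoff exponent is of order n: it
  amplifies the probability of the bad event by a factor exponential in n, and only a bound exp(-cn)
  absorbs this when the exponent is a small multiple of n. Such an exponent localises the fields
  only up to a fixed distance. The rate 1/n comes from the second step, where that distance makes
  the cubic terms a small multiple of the second moment. The fields are studied instead of the edge
  indicators because a field averages over many edges and concentrates, while a single indicator
  does not. The replacements in the first step are one-sided inequalities, which a negative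
  coefficient would reverse. A negative \<open>\<beta>\<^sub>1\<close> is harmless: deleting the
  root edge from \<open>H\<^sub>1\<close> leaves no edge, so its contribution to the field is
  constant and nothing is replaced in it.\<close>

definition logistic :: "real \<Rightarrow> real" where
  "logistic t = exp t / (1 + exp t)"

lemma logistic_pos: "0 < logistic t"
  by (simp add: logistic_def add_pos_pos)

lemma logistic_less_1: "logistic t < 1"
  by (simp add: logistic_def add_pos_pos)

lemma logistic_alt: "logistic t = 1 - 1 / (1 + exp t)"
proof -
  have "1 + exp t \<noteq> 0" using exp_gt_zero[of t] by linarith
  then show ?thesis by (simp add: logistic_def field_simps)
qed

lemma logistic_mono: "s \<le> t \<Longrightarrow> logistic s \<le> logistic t"
  unfolding logistic_alt by (simp add: frac_le add_pos_pos)

lemma logistic_strict_mono: "s < t \<Longrightarrow> logistic s < logistic t"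
  unfolding logistic_alt by (simp add: frac_less2 add_pos_pos)

lemma logistic_inj: "logistic s = logistic t \<Longrightarrow> s = t"
  using logistic_strict_mono[of s t] logistic_strict_mono[of t s] by fastforce

lemma has_real_derivative_logistic [derivative_intros]:
  assumes "(g has_real_derivative g') (at x within S)"
  shows "((\<lambda>x. logistic (g x)) has_real_derivative
           logistic (g x) * (1 - logistic (g x)) * g') (at x within S)"
proof -
  have nz: "1 + exp (g x) \<noteq> 0" using exp_gt_zero[of "g x"] by linarith
  have "((\<lambda>x. exp (g x) / (1 + exp (g x))) has_real_derivative
      (exp (g x) * g' * (1 + exp (g x)) - exp (g x) * (0 + exp (g x) * g')) /
      ((1 + exp (g x)) * (1 + exp (g x)))) (at x within S)"
    by (intro DERIV_divide DERIV_add DERIV_const DERIV_chain2[OF DERIV_exp] assms nz)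
  also have "(exp (g x) * g' * (1 + exp (g x)) - exp (g x) * (0 + exp (g x) * g')) /
      ((1 + exp (g x)) * (1 + exp (g x))) = logistic (g x) * (1 - logistic (g x)) * g'"
    using nz by (simp add: logistic_def field_simps)
  finally show ?thesis unfolding logistic_def .
qed

lemma continuous_on_logistic [continuous_intros]:
  assumes "continuous_on S g"
  shows "continuous_on S (\<lambda>x. logistic (g x))"
  unfolding logistic_alt
  by (intro continuous_intros assms ballI) (metis add_pos_pos exp_gt_zero less_numeral_extra(1,3))

lemma logistic_mvt:
  obtains u where "\<bar>u - s\<bar> \<le> \<bar>t - s\<bar>"
    "logistic t - logistic s = logistic u * (1 - logistic u) * (t - s)"
proof -
  have D: "(logistic has_real_derivative logistic x * (1 - logistic x)) (at x)" for x
    using has_real_derivative_logistic[OF DERIV_ident, of x UNIV] by simp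
  consider "s < t" | "s = t" | "t < s" by linarith
  then show thesis
  proof cases
    case 1
    obtain u where "s < u" "u < t" "logistic t - logistic s = (t - s) * (logistic u * (1 - logistic u))"
      using MVT2[OF 1, of logistic "\<lambda>x. logistic x * (1 - logistic x)"] D by blast
    then show thesis by (intro that[of u]) (auto simp: mult_ac)
  next
    case 2
    then show thesis by (intro that[of s]) auto
  next
    case 3
    obtain u where "t < u" "u < s" "logistic s - logistic t = (s - t) * (logistic u * (1 - logistic u))"
      using MVT2[OF 3, of logistic "\<lambda>x. logistic x * (1 - logistic x)"] D by blast
    then show thesis by (intro that[of u]) (auto simp: algebra_simps)
  qed
qed

lemma logistic_var_bounds: "0 \<le> logistic u * (1 - logistic u)" "logistic u * (1 - logistic u) \<le> 1"
  using logistic_pos[of u] logistic_less_1[of u] by (auto intro: mult_le_one)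

lemma logistic_lipschitz: "\<bar>logistic t - logistic s\<bar> \<le> \<bar>t - s\<bar>"
proof -
  obtain u where "logistic t - logistic s = logistic u * (1 - logistic u) * (t - s)"
    by (rule logistic_mvt)
  then show ?thesis
    using logistic_var_bounds[of u] by (simp add: abs_mult mult_left_le_one_le)
qed

text \<open>With v = logistic, the slope v(1 - v) at an intermediate point u is compared with the
  slope at s. The difference factors as (v(u) - v(s)) (1 - v(u) - v(s)), where the second factor has
  modulus at most 1 and the first is at most |t - s|.\<close>

lemma logistic_taylor:
  "\<bar>logistic t - logistic s - logistic s * (1 - logistic s) * (t - s)\<bar> \<le> (t - s)\<^sup>2"
proof -
  obtain u where u: "\<bar>u - s\<bar> \<le> \<bar>t - s\<bar>"
    "logistic t - logistic s = logistic u * (1 - logistic u) * (t - s)"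
    by (rule logistic_mvt)
  have "logistic t - logistic s - logistic s * (1 - logistic s) * (t - s) =
    (logistic u - logistic s) * (1 - logistic u - logistic s) * (t - s)"
    unfolding u(2) by (simp add: algebra_simps)
  also have "\<bar>\<dots>\<bar> \<le> (\<bar>t - s\<bar> * 1) * \<bar>t - s\<bar>"
    unfolding abs_mult
  proof (intro mult_mono)
    show "\<bar>logistic u - logistic s\<bar> \<le> \<bar>t - s\<bar>"
      using logistic_lipschitz[of u s] u(1) by linarith
    show "\<bar>1 - logistic u - logistic s\<bar> \<le> 1"
      using logistic_pos[of u] logistic_less_1[of u] logistic_pos[of s] logistic_less_1[of s]
      by linarith
  qed auto
  finally show ?thesis by (simp add: power2_eq_square)
qed

section \<open>Conditional probabilities under a Gibbs measure\<close>

locale gibbs =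
  fixes E :: "'e set" and f :: "'e set \<Rightarrow> real"
  assumes finite_E: "finite E"
begin

definition mean :: "('e set \<Rightarrow> real) \<Rightarrow> real" where
  "mean g = (\<Sum>x\<in>Pow E. exp (f x) * g x) / (\<Sum>x\<in>Pow E. exp (f x))"

definition field :: "'e \<Rightarrow> 'e set \<Rightarrow> real" where
  "field e x = f (insert e x) - f (x - {e})"

abbreviation prob where
  "prob Q \<equiv> mean (\<lambda>x. of_bool (Q x))"

lemma Z_pos: "0 < (\<Sum>x\<in>Pow E. exp (f x))"
  using finite_E by (intro sum_pos) auto

lemma mean_cong: "(\<And>x. x \<subseteq> E \<Longrightarrow> g x = h x) \<Longrightarrow> mean g = mean h"
  unfolding mean_def by (auto intro!: sum.cong arg_cong2[where f = "(/)"])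

lemma mean_mono: "(\<And>x. x \<subseteq> E \<Longrightarrow> g x \<le> h x) \<Longrightarrow> mean g \<le> mean h"
  unfolding mean_def using Z_pos
  by (intro divide_right_mono sum_mono mult_left_mono) auto

lemma mean_const [simp]: "mean (\<lambda>_. a) = a"
  unfolding mean_def using Z_pos by (simp flip: sum_distrib_right)

lemma mean_add: "mean (\<lambda>x. g x + h x) = mean g + mean h"
  unfolding mean_def by (simp add: distrib_left sum.distrib add_divide_distrib)

lemma mean_diff: "mean (\<lambda>x. g x - h x) = mean g - mean h"
  unfolding mean_def by (simp add: right_diff_distrib sum_subtractf diff_divide_distrib)

lemma mean_cmult: "mean (\<lambda>x. a * g x) = a * mean g"
  unfolding mean_def by (simp add: sum_distrib_left mult_ac)

lemma mean_sum: "mean (\<lambda>x. \<Sum>i\<in>I. g i x) = (\<Sum>i\<in>I. mean (g i))"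
  unfolding mean_def sum_distrib_left by (subst sum.swap) (simp add: sum_divide_distrib)

lemma mean_nonneg: "(\<And>x. x \<subseteq> E \<Longrightarrow> 0 \<le> g x) \<Longrightarrow> 0 \<le> mean g"
  using mean_mono[of "\<lambda>_. 0" g] by simp

lemma abs_mean_le: "\<bar>mean g\<bar> \<le> mean (\<lambda>x. \<bar>g x\<bar>)"
proof -
  have "mean g \<le> mean (\<lambda>x. \<bar>g x\<bar>)" by (rule mean_mono) simp
  moreover have "- mean g \<le> mean (\<lambda>x. \<bar>g x\<bar>)"
    using mean_mono[of "\<lambda>x. - 1 * g x" "\<lambda>x. \<bar>g x\<bar>"] unfolding mean_cmult by simp
  ultimately show ?thesis by linarith
qed

lemma abs_mean_le_const:
  assumes "\<And>x. x \<subseteq> E \<Longrightarrow> \<bar>g x\<bar> \<le> a"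
  shows "\<bar>mean g\<bar> \<le> a"
  using abs_mean_le[of g] mean_mono[of "\<lambda>x. \<bar>g x\<bar>" "\<lambda>_. a"] assms by simp

text \<open>Configurations are grouped into pairs {x, insert e x} with e outside x. The field of e
  agrees on both members, and the total weight of the pair times \<open>logistic (field e x)\<close>
  is the weight of \<open>insert e x\<close>.\<close>

lemma mean_of_mem:
  assumes "e \<in> E"
  shows "mean (\<lambda>x. of_bool (e \<in> x) * g x) = mean (\<lambda>x. logistic (field e x) * g (insert e x))"
proof -
  define P where "P = Pow (E - {e})"
  have P: "Pow E = P \<union> insert e ` P"
    using Pow_insert[of e "E - {e}"] assms by (simp add: P_def insert_absorb)
  have split: "(\<Sum>x\<in>Pow E. u x) = (\<Sum>x\<in>P. u x + u (insert e x))" for u :: "'e set \<Rightarrow> real"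
  proof -
    have "inj_on (insert e) P" by (auto simp: inj_on_def P_def)
    moreover have "P \<inter> insert e ` P = {}" by (auto simp: P_def)
    moreover have "finite P" using finite_E by (simp add: P_def)
    ultimately show ?thesis
      unfolding P by (simp add: sum.union_disjoint sum.reindex sum.distrib)
  qed
  have "exp (f x) * (of_bool (e \<in> x) * g x) +
      exp (f (insert e x)) * (of_bool (e \<in> insert e x) * g (insert e x)) =
      exp (f x) * (logistic (field e x) * g (insert e x)) +
      exp (f (insert e x)) * (logistic (field e (insert e x)) * g (insert e (insert e x)))"
    if "x \<in> P" for x
  proof -
    have x: "e \<notin> x" "x - {e} = x" "insert e x - {e} = x" using that by (auto simp: P_def)
    have pos: "exp (f x) + exp (f (insert e x)) > 0" by (simp add: add_pos_pos)
    have "logistic (field e x) = exp (f (insert e x)) / (exp (f x) + exp (f (insert e x)))"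
      using pos by (simp add: field_def logistic_def x exp_diff field_simps)
    moreover have "field e (insert e x) = field e x" by (simp add: field_def x)
    ultimately have "exp (f (insert e x)) * g (insert e x) =
      (exp (f x) + exp (f (insert e x))) * (logistic (field e x) * g (insert e x))"
      using pos by (simp add: field_simps)
    then show ?thesis
      using \<open>field e (insert e x) = field e x\<close> x by (simp add: algebra_simps)
  qed
  then show ?thesis
    unfolding mean_def split by (intro arg_cong2[where f = "(/)"] sum.cong refl)
qed

end

section \<open>Propagation of tail bounds\<close>

text \<open>The field of an edge is a weighted count of the sets \<open>A e \<tau>\<close> contained in the
  configuration. For the ERGM, \<open>r = 1/n\<close>, \<open>F = 2\<Phi>\<close> and \<open>F' = 2\<Phi>'\<close>. A coefficient \<open>c \<tau>\<close> may be
  negative only if \<open>A e \<tau>\<close> is empty; this is what allows a negative \<open>\<beta>\<^sub>1\<close>.\<close>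

locale mean_field = gibbs E f for E :: "'e set" and f +
  fixes T :: "'e \<Rightarrow> 't set" and c :: "'t \<Rightarrow> real" and A :: "'e \<Rightarrow> 't \<Rightarrow> 'e set"
    and F F' :: "real \<Rightarrow> real" and K r :: real
  assumes E_nonempty: "E \<noteq> {}"
    and A_subset: "\<lbrakk>e \<in> E; \<tau> \<in> T e\<rbrakk> \<Longrightarrow> A e \<tau> \<subseteq> E"
    and c_sign: "\<lbrakk>e \<in> E; \<tau> \<in> T e\<rbrakk> \<Longrightarrow> A e \<tau> = {} \<or> 0 \<le> c \<tau>"
    and field_eq: "\<lbrakk>e \<in> E; x \<subseteq> E\<rbrakk> \<Longrightarrow> field e x = (\<Sum>\<tau>\<in>T e. c \<tau> * of_bool (A e \<tau> \<subseteq> x))"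
    and field_bound: "\<lbrakk>e \<in> E; x \<subseteq> E\<rbrakk> \<Longrightarrow> \<bar>field e x\<bar> \<le> K"
    and field_influence:
      "\<lbrakk>e \<in> E; j \<in> E; x \<subseteq> E\<rbrakk> \<Longrightarrow> \<bar>field e (insert j x) - field e x\<bar> \<le> K * r"
    and F_approx:
      "\<lbrakk>e \<in> E; 0 \<le> a; a \<le> 1\<rbrakk> \<Longrightarrow> \<bar>(\<Sum>\<tau>\<in>T e. c \<tau> * a ^ card (A e \<tau>)) - F a\<bar> \<le> K * r"
    and F'_bound:
      "\<lbrakk>e \<in> E; 0 \<le> a; a \<le> 1\<rbrakk> \<Longrightarrow>
         (\<Sum>\<tau>\<in>T e. c \<tau> * (real (card (A e \<tau>)) * a ^ (card (A e \<tau>) - 1))) \<le> F' a"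
    and F'_le: "\<lbrakk>0 \<le> a; a \<le> 1\<rbrakk> \<Longrightarrow> F' a \<le> K"
    and card_sq: "e \<in> E \<Longrightarrow> (\<Sum>\<tau>\<in>T e. c \<tau> * (real (card (A e \<tau>)))\<^sup>2) \<le> K"
    and r_pos: "0 < r" and K_ge_1: "1 \<le> K"
begin

text \<open>Where \<open>c \<tau>\<close> may be negative, \<open>A e \<tau>\<close> is empty;
  demanding equality in that case allows a termwise comparison in spite of the sign.\<close>

lemma c_card_mult_mono:
  assumes "e \<in> E" "\<tau> \<in> T e" "0 < card (A e \<tau>) \<Longrightarrow> u \<le> v" "card (A e \<tau>) = 0 \<Longrightarrow> u = v"
  shows "c \<tau> * u \<le> c \<tau> * v"
  using assms c_sign[OF assms(1,2)] by (cases "card (A e \<tau>) = 0") (auto intro: mult_left_mono)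

lemma card_sum_le:
  assumes "e \<in> E"
  shows "(\<Sum>\<tau>\<in>T e. c \<tau> * real (card (A e \<tau>))) \<le> K"
proof -
  have "(\<Sum>\<tau>\<in>T e. c \<tau> * real (card (A e \<tau>))) \<le> (\<Sum>\<tau>\<in>T e. c \<tau> * (real (card (A e \<tau>)))\<^sup>2)"
  proof (intro sum_mono c_card_mult_mono[OF assms])
    fix \<tau> assume "0 < card (A e \<tau>)"
    then show "real (card (A e \<tau>)) \<le> (real (card (A e \<tau>)))\<^sup>2"
      by (simp add: power2_eq_square)
  qed auto
  then show ?thesis using card_sq[OF assms] by linarith
qed

lemma mean_subset_insert:
  assumes "j \<in> E" "j \<notin> S"
  shows "mean (\<lambda>x. of_bool (insert j S \<subseteq> x) * G x) =
    mean (\<lambda>x. logistic (field j x) * (of_bool (S \<subseteq> x) * G (insert j x)))"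
proof -
  have "mean (\<lambda>x. of_bool (insert j S \<subseteq> x) * G x) =
      mean (\<lambda>x. of_bool (j \<in> x) * (of_bool (S \<subseteq> x) * G x))"
    by (rule mean_cong) auto
  also have "\<dots> = mean (\<lambda>x. logistic (field j x) * (of_bool (S \<subseteq> insert j x) * G (insert j x)))"
    by (rule mean_of_mem[OF assms(1)])
  also have "\<dots> = mean (\<lambda>x. logistic (field j x) * (of_bool (S \<subseteq> x) * G (insert j x)))"
    by (rule mean_cong) (use assms in \<open>simp add: subset_insert\<close>)
  finally show ?thesis .
qed

text \<open>The sign \<open>s\<close> serves to treat the upper and the lower tail at once.\<close>

lemma mean_subset_one_sided:
  assumes "finite S" "S \<subseteq> E" and s: "s = 1 \<or> s = (-1::real)"
    and G: "\<And>x. x \<subseteq> E \<Longrightarrow> 0 \<le> G x" "\<And>x. x \<subseteq> E \<Longrightarrow> G x \<le> g"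
    and infl: "\<And>j x. \<lbrakk>j \<in> E; x \<subseteq> E\<rbrakk> \<Longrightarrow> \<bar>G (insert j x) - G x\<bar> \<le> \<rho> * G x"
    and bad: "\<And>j. j \<in> E \<Longrightarrow> prob (\<lambda>x. s * t < s * field j x) \<le> \<eta>"
  shows "s * mean (\<lambda>x. of_bool (S \<subseteq> x) * G x) \<le>
    s * logistic t ^ card S * mean G + real (card S) * (\<rho> * mean G + g * \<eta>)"
  using assms(1,2)
proof (induction S rule: finite_induct)
  case (insert j S)
  have j: "j \<in> E" using insert by auto
  let ?v = "logistic t"
  have v: "0 < ?v" "?v < 1" by (rule logistic_pos logistic_less_1)+
  have g: "0 \<le> g" using G[of "{}"] by simp
  have err: "0 \<le> \<rho> * mean G + g * \<eta>"
  proof -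
    have "0 \<le> mean (\<lambda>x. \<rho> * G x)"
      using infl[OF j] by (intro mean_nonneg) (meson abs_ge_zero order_trans)
    moreover have "0 \<le> \<eta>" by (rule order_trans[OF mean_nonneg bad[OF j]]) auto
    ultimately show ?thesis using g by (simp add: mean_cmult)
  qed
  have "s * mean (\<lambda>x. of_bool (insert j S \<subseteq> x) * G x) =
    mean (\<lambda>x. s * (logistic (field j x) * (of_bool (S \<subseteq> x) * G (insert j x))))"
    using mean_subset_insert[OF j, of S G] insert.hyps
    by (simp add: mean_cmult del: insert_subset)
  \<comment> \<open>Two replacements: passing from \<open>G (insert j x)\<close> to
    \<open>G x\<close> costs \<open>\<rho> * G x\<close>, and passing from
    \<open>logistic (field j x)\<close> to its value at t is free when the field lies on the right
    side of t and costs at most g on the bad event.\<close>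
  also have "\<dots> \<le> mean (\<lambda>x. s * ?v * (of_bool (S \<subseteq> x) * G x) +
      (\<rho> * G x + g * of_bool (s * t < s * field j x)))"
  proof (rule mean_mono)
    fix x assume x: "x \<subseteq> E"
    let ?l = "logistic (field j x)" and ?u = "of_bool (S \<subseteq> x) :: real"
    have l: "0 < ?l" "?l < 1" by (rule logistic_pos logistic_less_1)+
    have "s * ?l * ?u * (G (insert j x) - G x) \<le> \<bar>s * ?l * ?u\<bar> * \<bar>G (insert j x) - G x\<bar>"
      using abs_ge_self[of "s * ?l * ?u * (G (insert j x) - G x)"] by (simp add: abs_mult)
    also have "\<dots> \<le> 1 * (\<rho> * G x)"
      using s l by (intro mult_mono infl[OF j x]) (auto simp: abs_mult)
    finally have 1: "s * ?l * ?u * (G (insert j x) - G x) \<le> \<rho> * G x" by simp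
    have "(s * ?l - s * ?v) * (?u * G x) \<le> g * of_bool (s * t < s * field j x)"
    proof (cases "s * t < s * field j x")
      case True
      have "(s * ?l - s * ?v) * (?u * G x) \<le> 1 * (1 * g)"
        using s l v G[OF x] by (intro mult_mono) auto
      then show ?thesis using True by simp
    next
      case False
      then have "s * ?l \<le> s * ?v" using s logistic_mono by auto
      then have "(s * ?l - s * ?v) * (?u * G x) \<le> 0"
        using G[OF x] by (intro mult_nonpos_nonneg) auto
      then show ?thesis using False by simp
    qed
    then show "s * (?l * (?u * G (insert j x))) \<le> s * ?v * (?u * G x) +
      (\<rho> * G x + g * of_bool (s * t < s * field j x))"
      using 1 by (simp add: algebra_simps)
  qed
  also have "\<dots> = ?v * (s * mean (\<lambda>x. of_bool (S \<subseteq> x) * G x)) +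
      (\<rho> * mean G + g * prob (\<lambda>x. s * t < s * field j x))"
    by (simp add: mean_add mean_cmult)
  also have "\<dots> \<le> ?v * (s * ?v ^ card S * mean G + real (card S) * (\<rho> * mean G + g * \<eta>)) +
      (\<rho> * mean G + g * \<eta>)"
    using insert v g bad[OF j] by (intro add_mono[OF _ add_mono] mult_left_mono order_refl) auto
  also have "\<dots> \<le> s * ?v ^ Suc (card S) * mean G +
      (1 * (real (card S) * (\<rho> * mean G + g * \<eta>)) + (\<rho> * mean G + g * \<eta>))"
  proof -
    have "?v * (real (card S) * (\<rho> * mean G + g * \<eta>)) \<le> 1 * (real (card S) * (\<rho> * mean G + g * \<eta>))"
      using v err by (intro mult_right_mono mult_nonneg_nonneg) auto
    then show ?thesis by (simp add: algebra_simps)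
  qed
  also have "\<dots> = s * ?v ^ card (insert j S) * mean G +
      real (card (insert j S)) * (\<rho> * mean G + g * \<eta>)"
    using insert by (simp add: algebra_simps)
  finally show ?case .
qed simp

text \<open>Each set \<open>A e \<tau>\<close> in the expansion of the field is treated separately.
  The main terms reassemble to \<open>F (logistic t)\<close>, and each replaced edge contributes one
  error, which \<open>card_sum_le\<close> sums up.\<close>

lemma mean_field_one_sided:
  assumes e: "e \<in> E" and s: "s = 1 \<or> s = (-1::real)"
    and G: "\<And>x. x \<subseteq> E \<Longrightarrow> 0 \<le> G x" "\<And>x. x \<subseteq> E \<Longrightarrow> G x \<le> g"
    and infl: "\<And>j x. \<lbrakk>j \<in> E; x \<subseteq> E\<rbrakk> \<Longrightarrow> \<bar>G (insert j x) - G x\<bar> \<le> \<rho> * G x"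
    and bad: "\<And>j. j \<in> E \<Longrightarrow> prob (\<lambda>x. s * t < s * field j x) \<le> \<eta>"
  shows "mean (\<lambda>x. s * field e x * G x) \<le>
    (s * F (logistic t) + K * r) * mean G + K * (\<rho> * mean G + g * \<eta>)"
proof -
  let ?v = "logistic t" and ?err = "\<rho> * mean G + g * \<eta>"
  have v: "0 < ?v" "?v < 1" by (rule logistic_pos logistic_less_1)+
  have mG: "0 \<le> mean G" using G by (intro mean_nonneg)
  have err: "0 \<le> ?err"
  proof -
    have "0 \<le> mean (\<lambda>x. \<rho> * G x)"
      using infl[OF e] by (intro mean_nonneg) (meson abs_ge_zero order_trans)
    moreover have "0 \<le> \<eta>" by (rule order_trans[OF mean_nonneg bad[OF e]]) auto
    moreover have "0 \<le> g" using G[of "{}"] by simp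
    ultimately show ?thesis by (simp add: mean_cmult)
  qed
  have "mean (\<lambda>x. s * field e x * G x) =
      mean (\<lambda>x. \<Sum>\<tau>\<in>T e. c \<tau> * (s * (of_bool (A e \<tau> \<subseteq> x) * G x)))"
    by (rule mean_cong) (simp add: field_eq[OF e] sum_distrib_left sum_distrib_right mult_ac)
  also have "\<dots> = (\<Sum>\<tau>\<in>T e. c \<tau> * (s * mean (\<lambda>x. of_bool (A e \<tau> \<subseteq> x) * G x)))"
    by (simp add: mean_sum mean_cmult)
  also have "\<dots> \<le> (\<Sum>\<tau>\<in>T e. c \<tau> * (s * ?v ^ card (A e \<tau>) * mean G + real (card (A e \<tau>)) * ?err))"
  proof (intro sum_mono c_card_mult_mono[OF e])
    fix \<tau> assume \<tau>: "\<tau> \<in> T e"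
    have fin: "finite (A e \<tau>)" using A_subset[OF e \<tau>] finite_E finite_subset by blast
    show "s * mean (\<lambda>x. of_bool (A e \<tau> \<subseteq> x) * G x) \<le>
      s * ?v ^ card (A e \<tau>) * mean G + real (card (A e \<tau>)) * ?err"
      using fin A_subset[OF e \<tau>] s G infl bad by (rule mean_subset_one_sided)
    \<comment> \<open>For an empty set both sides agree; this is the case in which the coefficient
      may be negative.\<close>
    show "s * mean (\<lambda>x. of_bool (A e \<tau> \<subseteq> x) * G x) =
      s * ?v ^ card (A e \<tau>) * mean G + real (card (A e \<tau>)) * ?err" if "card (A e \<tau>) = 0"
      using that fin by simp
  qed auto
  also have "\<dots> = s * (\<Sum>\<tau>\<in>T e. c \<tau> * ?v ^ card (A e \<tau>)) * mean G +
      (\<Sum>\<tau>\<in>T e. c \<tau> * real (card (A e \<tau>))) * ?err"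
    by (simp add: sum_distrib_left sum_distrib_right sum.distrib distrib_left mult_ac)
  also have "\<dots> \<le> (s * F ?v + K * r) * mean G + K * ?err"
    using s v mG err F_approx[OF e, of ?v] card_sum_le[OF e]
    by (intro add_mono mult_right_mono) auto
  finally show ?thesis .
qed

text \<open>A Chernoff bound: \<open>mean_field_one_sided\<close> with \<open>G x = exp (l s field e x)\<close> is a differential
  inequality for the moment generating function of the field.\<close>

lemma tail_step:
  assumes e: "e \<in> E" and s: "s = 1 \<or> s = (-1::real)" and L: "0 \<le> L"
    and bad: "\<And>j. j \<in> E \<Longrightarrow> prob (\<lambda>x. s * t < s * field j x) \<le> \<eta>"
  shows "prob (\<lambda>x. s * t' < s * field e x) \<le>
    exp (- L * (s * t' - (s * F (logistic t) + K * r + K * (exp (L * K * r) - 1) + K * exp (2 * L * K) * \<eta>)))"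
proof -
  \<comment> \<open>w bounds the logarithmic derivative of M on [0, L]. Its last term is the price
    of the bad event, amplified by \<open>exp (2 * L * K)\<close>.\<close>
  define w where "w = s * F (logistic t) + K * r + K * (exp (L * K * r) - 1) + K * exp (2 * L * K) * \<eta>"
  define M where "M l = mean (\<lambda>x. exp (l * (s * field e x)))" for l
  define M' where "M' l = mean (\<lambda>x. s * field e x * exp (l * (s * field e x)))" for l
  have \<eta>: "0 \<le> \<eta>" by (rule order_trans[OF mean_nonneg bad[OF e]]) auto
  have D: "(M has_real_derivative M' l) (at l)" for l
    unfolding M_def M'_def mean_def using Z_pos
    by (auto intro!: derivative_eq_intros sum.cong simp: mult_ac)
  have le: "M' l \<le> w * M l" if l: "0 \<le> l" "l \<le> L" for l
  proof -
    define G where "G = (\<lambda>x. exp (l * (s * field e x)))"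
    have sD: "\<bar>s * field e x\<bar> \<le> K" if "x \<subseteq> E" for x
      using s field_bound[OF e that] by auto
    have lD: "\<bar>l * (s * field e x)\<bar> \<le> L * K" if "x \<subseteq> E" for x
      unfolding abs_mult[of l] using sD[OF that] l by (intro mult_mono) auto
    have G2: "G x \<le> exp (L * K)" if "x \<subseteq> E" for x using lD[OF that] by (auto simp: G_def)
    have infl: "\<bar>G (insert j x) - G x\<bar> \<le> (exp (L * K * r) - 1) * G x"
      if "j \<in> E" "x \<subseteq> E" for j x
    proof -
      let ?y = "l * (s * (field e (insert j x) - field e x))"
      have y: "\<bar>?y\<bar> \<le> L * (K * r)"
        unfolding abs_mult[of l] using s l field_influence[OF e that] by (intro mult_mono) (auto simp: abs_mult)
      have "G (insert j x) = exp ?y * G x" by (simp add: G_def right_diff_distrib flip: exp_add)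
      then have "G (insert j x) - G x = (exp ?y - 1) * G x" by (simp only: left_diff_distrib mult_1)
      then have "\<bar>G (insert j x) - G x\<bar> = \<bar>exp ?y - 1\<bar> * G x" by (simp add: abs_mult G_def)
      moreover have "\<bar>exp ?y - 1\<bar> \<le> exp (L * K * r) - 1"
      proof -
        have "exp ?y \<le> exp (L * (K * r))" "exp (- (L * (K * r))) \<le> exp ?y" using y by auto
        moreover have "1 - exp (- (L * (K * r))) \<le> exp (L * (K * r)) - 1"
          using cosh_real_ge_1[of "L * (K * r)"] by (simp add: cosh_def)
        ultimately have "\<bar>exp ?y - 1\<bar> \<le> exp (L * (K * r)) - 1" by linarith
        then show ?thesis by (simp only: mult.assoc)
      qed
      ultimately show ?thesis by (auto simp: G_def intro: mult_right_mono)
    qed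
    \<comment> \<open>The error from the bad event is additive. This lower bound turns it into a
      multiple of \<open>mean G\<close>, at the cost of a second factor \<open>exp (L * K)\<close>,
      so that a linear differential inequality results.\<close>
    have mG: "exp (- (L * K)) \<le> mean G"
    proof -
      have "mean (\<lambda>_. exp (- (L * K))) \<le> mean G"
        using lD by (intro mean_mono) (force simp: G_def abs_le_iff)
      then show ?thesis by simp
    qed
    have "M' l \<le> (s * F (logistic t) + K * r) * mean G +
        K * ((exp (L * K * r) - 1) * mean G + exp (L * K) * \<eta>)"
      unfolding M'_def G_def[symmetric]
      using mean_field_one_sided[OF e s, of G "exp (L * K)" "exp (L * K * r) - 1" t \<eta>] G2 infl bad
      by (simp add: G_def)
    also have "exp (L * K) * \<eta> \<le> exp (2 * L * K) * \<eta> * mean G"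
    proof -
      have "exp (2 * L * K) * exp (- (L * K)) = exp (L * K)" by (simp flip: exp_add)
      then have "exp (L * K) * \<eta> = exp (2 * L * K) * \<eta> * exp (- (L * K))"
        by (metis mult.assoc mult.commute)
      also have "\<dots> \<le> exp (2 * L * K) * \<eta> * mean G"
        using mG \<eta> by (intro mult_left_mono) auto
      finally show ?thesis .
    qed
    finally show ?thesis using K_ge_1 by (simp add: w_def M_def G_def algebra_simps)
  qed
  \<comment> \<open>Gronwall's argument: \<open>exp (- w * l) * M l\<close> is nonincreasing on
    [0, L], and M 0 = 1.\<close>
  have "exp (- w * L) * M L \<le> exp (- w * 0) * M 0"
  proof (rule DERIV_nonpos_imp_nonincreasing[OF L])
    fix l assume l: "0 \<le> l" "l \<le> L"
    have "((\<lambda>l. exp (- w * l) * M l) has_real_derivative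
        exp (- w * l) * (M' l - w * M l)) (at l)"
      by (auto intro!: derivative_eq_intros D simp: algebra_simps)
    moreover have "exp (- w * l) * (M' l - w * M l) \<le> 0"
      using le[OF l] by (intro mult_nonneg_nonpos) auto
    ultimately show "\<exists>y. ((\<lambda>l. exp (- w * l) * M l) has_real_derivative y) (at l) \<and> y \<le> 0" by blast
  qed
  then have M_le: "M L \<le> exp (w * L)"
    by (simp add: M_def exp_minus field_simps)
  have "prob (\<lambda>x. s * t' < s * field e x) \<le>
      mean (\<lambda>x. exp (- (L * (s * t'))) * exp (L * (s * field e x)))"
  proof (rule mean_mono)
    fix x
    have "1 \<le> exp (L * (s * field e x - s * t'))" if "s * t' < s * field e x"
      using that L by simp
    then show "of_bool (s * t' < s * field e x) \<le> exp (- (L * (s * t'))) * exp (L * (s * field e x))"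
      by (simp add: right_diff_distrib flip: exp_add)
  qed
  also have "\<dots> = exp (- (L * (s * t'))) * M L" by (simp add: mean_cmult M_def)
  also have "\<dots> \<le> exp (- (L * (s * t'))) * exp (w * L)" using M_le by simp
  also have "\<dots> = exp (- L * (s * t' - w))" by (simp add: right_diff_distrib mult.commute flip: exp_add)
  finally show ?thesis unfolding w_def .
qed

end

section \<open>First order expansion at the fixed point\<close>

context mean_field
begin

context
  fixes t p :: real
  assumes p_def: "p = logistic t"
begin

lemma p_bounds: "0 < p" "p < 1"
  unfolding p_def by (rule logistic_pos logistic_less_1)+

text \<open>The conditional probability of j given the other edges, minus p. It is the small
  quantity in which the expansion runs.\<close>

definition q where "q j x = logistic (field j x) - p"

lemma abs_q_le_1: "\<bar>q j x\<bar> \<le> 1"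
  unfolding q_def
  using p_bounds logistic_pos[of "field j x"] logistic_less_1[of "field j x"] by linarith

lemma abs_q_le: "\<bar>q j x\<bar> \<le> \<bar>field j x - t\<bar>"
  using logistic_lipschitz[of "field j x" t] unfolding p_def[symmetric] q_def .

lemma q_linear: "\<bar>q j x - p * (1 - p) * (field j x - t)\<bar> \<le> (field j x - t)\<^sup>2"
  using logistic_taylor[of "field j x" t] unfolding p_def[symmetric] q_def .

lemma q_influence:
  assumes "i \<in> E" "j \<in> E" "x \<subseteq> E"
  shows "\<bar>q j (insert i x) - q j x\<bar> \<le> K * r"
  using logistic_lipschitz[of "field j (insert i x)" "field j x"] field_influence[OF assms(2,1,3)]
  by (simp add: q_def)

text \<open>Integrating out j produces the factor \<open>p + q j\<close>; both terms are kept, and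
  only the shift of G costs an error. Bounding the term with q gives the zeroth order expansion,
  expanding it once more gives the first order one.\<close>

lemma mean_subset_insert_approx:
  assumes j: "j \<in> E" "j \<notin> S"
    and infl: "\<And>x. x \<subseteq> E \<Longrightarrow> \<bar>G (insert j x) - G x\<bar> \<le> \<omega>"
  shows "\<bar>mean (\<lambda>x. of_bool (insert j S \<subseteq> x) * G x) -
     p * mean (\<lambda>x. of_bool (S \<subseteq> x) * G x) -
     mean (\<lambda>x. of_bool (S \<subseteq> x) * (G x * q j x))\<bar> \<le> \<omega>"
proof -
  have "mean (\<lambda>x. of_bool (insert j S \<subseteq> x) * G x) -
     p * mean (\<lambda>x. of_bool (S \<subseteq> x) * G x) -
     mean (\<lambda>x. of_bool (S \<subseteq> x) * (G x * q j x)) =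
     mean (\<lambda>x. logistic (field j x) * of_bool (S \<subseteq> x) * (G (insert j x) - G x))"
    unfolding mean_subset_insert[OF j] mean_cmult[symmetric] mean_diff[symmetric]
    by (rule mean_cong) (simp add: q_def algebra_simps)
  also have "\<bar>\<dots>\<bar> \<le> \<omega>"
  proof (rule abs_mean_le_const)
    fix x assume x: "x \<subseteq> E"
    have "\<bar>logistic (field j x) * of_bool (S \<subseteq> x) * (G (insert j x) - G x)\<bar> \<le> 1 * \<omega>"
      unfolding abs_mult[of _ "G _ - G _"]
      using logistic_pos[of "field j x"] logistic_less_1[of "field j x"]
      by (intro mult_mono infl x) auto
    then show "\<bar>logistic (field j x) * of_bool (S \<subseteq> x) * (G (insert j x) - G x)\<bar> \<le> \<omega>" by simp
  qed
  finally show ?thesis .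
qed

text \<open>Every correction is put into the error; the lemma is meant for functions
  \<open>G x * q j x\<close> that are small already.\<close>

lemma mean_subset_zeroth_order:
  assumes "finite S" "S \<subseteq> E"
    and infl: "\<And>j x. \<lbrakk>j \<in> E; x \<subseteq> E\<rbrakk> \<Longrightarrow> \<bar>G (insert j x) - G x\<bar> \<le> \<omega>"
    and W: "\<And>j. j \<in> E \<Longrightarrow> mean (\<lambda>x. \<bar>G x * q j x\<bar>) \<le> W"
  shows "\<bar>mean (\<lambda>x. of_bool (S \<subseteq> x) * G x) - p ^ card S * mean G\<bar> \<le> real (card S) * (W + \<omega>)"
  using assms(1,2)
proof (induction S rule: finite_induct)
  case (insert j S)
  have j: "j \<in> E" using insert by auto
  let ?m = "\<lambda>S G. mean (\<lambda>x. of_bool (S \<subseteq> x) * G x)"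
  have 1: "\<bar>?m (insert j S) G - p * ?m S G - ?m S (\<lambda>x. G x * q j x)\<bar> \<le> \<omega>"
    using mean_subset_insert_approx[OF j insert.hyps(2)] infl[OF j] by blast
  have "\<bar>?m S (\<lambda>x. G x * q j x)\<bar> \<le> mean (\<lambda>x. \<bar>of_bool (S \<subseteq> x) * (G x * q j x)\<bar>)"
    by (rule abs_mean_le)
  also have "\<dots> \<le> mean (\<lambda>x. \<bar>G x * q j x\<bar>)" by (rule mean_mono) auto
  finally have 2: "\<bar>?m S (\<lambda>x. G x * q j x)\<bar> \<le> W" using W[OF j] by linarith
  have "p * \<bar>?m S G - p ^ card S * mean G\<bar> \<le> 1 * (real (card S) * (W + \<omega>))"
    using p_bounds insert by (intro mult_mono) auto
  then have 3: "\<bar>p * ?m S G - p ^ card (insert j S) * mean G\<bar> \<le> real (card S) * (W + \<omega>)"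
    using p_bounds insert.hyps by (simp add: abs_mult_pos[symmetric] abs_mult right_diff_distrib[symmetric] mult.assoc)
  have "real (card (insert j S)) * (W + \<omega>) = real (card S) * (W + \<omega>) + W + \<omega>"
    using insert.hyps by (simp add: algebra_simps)
  then show ?case using 1 2 3 by linarith
qed simp

text \<open>Removing the edges of S one by one leaves one linear term for each. To zeroth order it
  is the mean of \<open>G x * q j x\<close> times one factor p for every other edge of S. The sum
  has the form of the derivative of a^k at p, which is how \<open>F'\<close> enters later.\<close>

lemma mean_subset_first_order:
  assumes "finite S" "S \<subseteq> E"
    and infl: "\<And>j x. \<lbrakk>j \<in> E; x \<subseteq> E\<rbrakk> \<Longrightarrow> \<bar>G (insert j x) - G x\<bar> \<le> \<omega>"
    and infl2: "\<And>i j x. \<lbrakk>i \<in> E; j \<in> E; x \<subseteq> E\<rbrakk> \<Longrightarrow>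
       \<bar>G (insert i x) * q j (insert i x) - G x * q j x\<bar> \<le> \<omega>2"
    and Y: "\<And>j. j \<in> E \<Longrightarrow> \<bar>mean (\<lambda>x. G x * q j x)\<bar> \<le> Y"
    and W: "\<And>i j. \<lbrakk>i \<in> E; j \<in> E\<rbrakk> \<Longrightarrow> mean (\<lambda>x. \<bar>G x * q j x * q i x\<bar>) \<le> W"
  shows "\<bar>mean (\<lambda>x. of_bool (S \<subseteq> x) * G x) - p ^ card S * mean G\<bar> \<le>
    real (card S) * p ^ (card S - 1) * Y + (real (card S))\<^sup>2 * (W + \<omega>2 + \<omega>)"
  using assms(1,2)
proof (induction S rule: finite_induct)
  case (insert j S)
  have j: "j \<in> E" using insert by auto
  let ?m = "\<lambda>S G. mean (\<lambda>x. of_bool (S \<subseteq> x) * G x)" and ?k = "card S"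
  have nn: "0 \<le> \<omega>" "0 \<le> \<omega>2" "0 \<le> W" "0 \<le> Y"
    using infl[OF j, of "{}"] infl2[OF j j, of "{}"]
      order_trans[OF mean_nonneg W[OF j j]] Y[OF j] by auto
  have 1: "\<bar>?m (insert j S) G - p * ?m S G - ?m S (\<lambda>x. G x * q j x)\<bar> \<le> \<omega>"
    using mean_subset_insert_approx[OF j insert.hyps(2)] infl[OF j] by blast
  have "\<bar>?m S (\<lambda>x. G x * q j x) - p ^ ?k * mean (\<lambda>x. G x * q j x)\<bar> \<le> real ?k * (W + \<omega>2)"
    using insert.hyps insert.prems infl2 W j by (intro mean_subset_zeroth_order) auto
  moreover have "\<bar>p ^ ?k * mean (\<lambda>x. G x * q j x)\<bar> \<le> p ^ ?k * Y"
    using p_bounds Y[OF j] by (simp add: abs_mult)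
  ultimately have 2: "\<bar>?m S (\<lambda>x. G x * q j x)\<bar> \<le> p ^ ?k * Y + real ?k * (W + \<omega>2)" by linarith
  have "p * \<bar>?m S G - p ^ ?k * mean G\<bar> \<le>
      p * (real ?k * p ^ (?k - 1) * Y + (real ?k)\<^sup>2 * (W + \<omega>2 + \<omega>))"
    using p_bounds insert by (intro mult_left_mono) auto
  also have "\<dots> \<le> real ?k * p ^ ?k * Y + (real ?k)\<^sup>2 * (W + \<omega>2 + \<omega>)"
  proof -
    \<comment> \<open>For k = 0 the exponent k - 1 truncates to 0, and the identity holds because of
      the factor k.\<close>
    have "p * (real ?k * p ^ (?k - 1) * Y) = real ?k * p ^ ?k * Y" by (cases ?k) auto
    moreover have "p * ((real ?k)\<^sup>2 * (W + \<omega>2 + \<omega>)) \<le> (real ?k)\<^sup>2 * (W + \<omega>2 + \<omega>)"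
      using p_bounds nn by (intro mult_left_le_one_le) auto
    ultimately show ?thesis unfolding distrib_left[of p] by linarith
  qed
  finally have 3: "\<bar>p * ?m S G - p ^ card (insert j S) * mean G\<bar> \<le>
      real ?k * p ^ ?k * Y + (real ?k)\<^sup>2 * (W + \<omega>2 + \<omega>)"
    using p_bounds insert.hyps by (simp add: abs_mult_pos[symmetric] abs_mult right_diff_distrib[symmetric] mult.assoc)
  \<comment> \<open>k^2 + k + 1 <= (k + 1)^2: the quadratic prefactor absorbs the errors of the
    zeroth order expansion at each removal.\<close>
  have "(real ?k)\<^sup>2 * (W + \<omega>2 + \<omega>) + real ?k * (W + \<omega>2) + \<omega> \<le> (real ?k + 1)\<^sup>2 * (W + \<omega>2 + \<omega>)"
    using nn by (simp add: power2_eq_square algebra_simps)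
  then have "\<bar>?m (insert j S) G - p ^ card (insert j S) * mean G\<bar> \<le>
      (real ?k + 1) * p ^ ?k * Y + (real ?k + 1)\<^sup>2 * (W + \<omega>2 + \<omega>)"
    using 1 2 3 by (simp add: distrib_right)
  then show ?case using insert.hyps by (simp add: add.commute)
qed simp

text \<open>Summed against the coefficients, the zeroth order terms give F p times the mean of G up
  to \<open>K * r\<close>, which cancels against t = F p; the linear terms give
  \<open>F' p * Y\<close>.\<close>

lemma mean_field_first_order:
  assumes e: "e \<in> E" and t: "t = F p"
    and infl: "\<And>j x. \<lbrakk>j \<in> E; x \<subseteq> E\<rbrakk> \<Longrightarrow> \<bar>G (insert j x) - G x\<bar> \<le> \<omega>"
    and infl2: "\<And>i j x. \<lbrakk>i \<in> E; j \<in> E; x \<subseteq> E\<rbrakk> \<Longrightarrow>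
       \<bar>G (insert i x) * q j (insert i x) - G x * q j x\<bar> \<le> \<omega>2"
    and Y: "\<And>j. j \<in> E \<Longrightarrow> \<bar>mean (\<lambda>x. G x * q j x)\<bar> \<le> Y"
    and W: "\<And>i j. \<lbrakk>i \<in> E; j \<in> E\<rbrakk> \<Longrightarrow> mean (\<lambda>x. \<bar>G x * q j x * q i x\<bar>) \<le> W"
  shows "\<bar>mean (\<lambda>x. (field e x - t) * G x)\<bar> \<le>
    F' p * Y + K * (W + \<omega>2 + \<omega>) + K * r * \<bar>mean G\<bar>"
proof -
  let ?m = "\<lambda>S. mean (\<lambda>x. of_bool (S \<subseteq> x) * G x)" and ?k = "\<lambda>\<tau>. card (A e \<tau>)"
  have nn: "0 \<le> \<omega>" "0 \<le> \<omega>2" "0 \<le> W" "0 \<le> Y"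
    using infl[OF e, of "{}"] infl2[OF e e, of "{}"]
      order_trans[OF mean_nonneg W[OF e e]] Y[OF e] by auto
  have "mean (\<lambda>x. (field e x - t) * G x) =
      mean (\<lambda>x. (\<Sum>\<tau>\<in>T e. c \<tau> * (of_bool (A e \<tau> \<subseteq> x) * G x)) - t * G x)"
    by (rule mean_cong) (simp add: field_eq[OF e] sum_distrib_left algebra_simps)
  also have "\<dots> = (\<Sum>\<tau>\<in>T e. c \<tau> * ?m (A e \<tau>)) - t * mean G"
    by (simp add: mean_diff mean_sum mean_cmult)
  also have "\<dots> = (\<Sum>\<tau>\<in>T e. c \<tau> * (?m (A e \<tau>) - p ^ ?k \<tau> * mean G)) +
      ((\<Sum>\<tau>\<in>T e. c \<tau> * p ^ ?k \<tau>) - F p) * mean G"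
    by (simp add: t[symmetric] sum_distrib_left sum_subtractf algebra_simps)
  finally have eq: "mean (\<lambda>x. (field e x - t) * G x) = \<dots>" .
  have "\<bar>\<Sum>\<tau>\<in>T e. c \<tau> * (?m (A e \<tau>) - p ^ ?k \<tau> * mean G)\<bar> \<le>
      (\<Sum>\<tau>\<in>T e. c \<tau> * (real (?k \<tau>) * p ^ (?k \<tau> - 1) * Y + (real (?k \<tau>))\<^sup>2 * (W + \<omega>2 + \<omega>)))"
  proof (rule order_trans[OF sum_abs], rule sum_mono)
    fix \<tau> assume \<tau>: "\<tau> \<in> T e"
    have fin: "finite (A e \<tau>)" using A_subset[OF e \<tau>] finite_E finite_subset by blast
    have "\<bar>?m (A e \<tau>) - p ^ ?k \<tau> * mean G\<bar> \<le>
        real (?k \<tau>) * p ^ (?k \<tau> - 1) * Y + (real (?k \<tau>))\<^sup>2 * (W + \<omega>2 + \<omega>)"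
      using fin A_subset[OF e \<tau>] infl infl2 Y W by (rule mean_subset_first_order)
    then show "\<bar>c \<tau> * (?m (A e \<tau>) - p ^ ?k \<tau> * mean G)\<bar> \<le>
        c \<tau> * (real (?k \<tau>) * p ^ (?k \<tau> - 1) * Y + (real (?k \<tau>))\<^sup>2 * (W + \<omega>2 + \<omega>))"
      using c_sign[OF e \<tau>] by (cases "A e \<tau> = {}") (auto simp: abs_mult intro: mult_left_mono)
  qed
  also have "\<dots> = (\<Sum>\<tau>\<in>T e. c \<tau> * (real (?k \<tau>) * p ^ (?k \<tau> - 1))) * Y +
      (\<Sum>\<tau>\<in>T e. c \<tau> * (real (?k \<tau>))\<^sup>2) * (W + \<omega>2 + \<omega>)"
    by (simp add: sum_distrib_left sum.distrib distrib_left mult_ac)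
  also have "\<dots> \<le> F' p * Y + K * (W + \<omega>2 + \<omega>)"
    using p_bounds nn F'_bound[OF e] card_sq[OF e] by (intro add_mono mult_right_mono) auto
  finally have 1: "\<bar>\<Sum>\<tau>\<in>T e. c \<tau> * (?m (A e \<tau>) - p ^ ?k \<tau> * mean G)\<bar> \<le> \<dots>" .
  have "\<bar>((\<Sum>\<tau>\<in>T e. c \<tau> * p ^ ?k \<tau>) - F p) * mean G\<bar> \<le> K * r * \<bar>mean G\<bar>"
    unfolding abs_mult using F_approx[OF e, of p] p_bounds by (intro mult_right_mono) auto
  then show ?thesis using 1 unfolding eq by linarith
qed

section \<open>Self-bounding estimates for the second moment of the fields and for the edge
  probabilities\<close>

context
  fixes \<delta> \<epsilon> :: real
  assumes t_eq: "t = F p" and t_le: "\<bar>t\<bar> \<le> K"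
    and contr: "F' p * (p * (1 - p)) \<le> 1 - \<delta>" and \<delta>: "0 < \<delta>"
    and \<epsilon>: "0 < \<epsilon>" "4 * K * \<epsilon> \<le> \<delta>"
    and bad: "\<And>j. j \<in> E \<Longrightarrow> prob (\<lambda>x. \<epsilon> < \<bar>field j x - t\<bar>) \<le> r"
begin

abbreviation h where "h j x \<equiv> field j x - t"

text \<open>The bound for one edge involves the fields of the others; passing to the maximum turns
  it into an inequality for a single number.\<close>

definition V where "V = Max ((\<lambda>e. mean (\<lambda>x. (h e x)\<^sup>2)) ` E)"

lemma V_ge: "e \<in> E \<Longrightarrow> mean (\<lambda>x. (h e x)\<^sup>2) \<le> V"
  unfolding V_def using finite_E by (intro Max_ge) auto

lemma V_nonneg: "0 \<le> V"
proof -
  obtain e where "e \<in> E" using E_nonempty by blast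
  show ?thesis by (rule order_trans[OF mean_nonneg V_ge[OF \<open>e \<in> E\<close>]]) auto
qed

lemma h_le: "\<lbrakk>e \<in> E; x \<subseteq> E\<rbrakk> \<Longrightarrow> \<bar>h e x\<bar> \<le> 2 * K"
  using field_bound[of e x] t_le by linarith

lemma mean_abs_hh: 
  assumes "i \<in> E" "j \<in> E"
  shows "mean (\<lambda>x. \<bar>h i x * h j x\<bar>) \<le> V"
proof -
  have "mean (\<lambda>x. \<bar>h i x * h j x\<bar>) \<le> mean (\<lambda>x. 1/2 * ((h i x)\<^sup>2 + (h j x)\<^sup>2))"
  proof (rule mean_mono)
    fix x
    have "0 \<le> (\<bar>h i x\<bar> - \<bar>h j x\<bar>)\<^sup>2" by simp
    then show "\<bar>h i x * h j x\<bar> \<le> 1/2 * ((h i x)\<^sup>2 + (h j x)\<^sup>2)"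
      by (simp add: power2_diff abs_mult)
  qed
  also have "\<dots> \<le> 1/2 * (V + V)"
    unfolding mean_cmult mean_add using assms by (intro mult_left_mono add_mono V_ge) auto
  also have "\<dots> = V" by simp
  finally show ?thesis .
qed

text \<open>The third factor is at most \<open>\<epsilon>\<close> off the bad event, which has probability at most \<open>r\<close>.\<close>

lemma mean_triple:
  assumes "i \<in> E" "j \<in> E" "l \<in> E"
    and u: "\<And>x. x \<subseteq> E \<Longrightarrow> 0 \<le> u x \<and> u x \<le> \<bar>h l x\<bar>"
  shows "mean (\<lambda>x. \<bar>h i x * h j x\<bar> * u x) \<le> \<epsilon> * V + 8 * K ^ 3 * r"
proof -
  have "mean (\<lambda>x. \<bar>h i x * h j x\<bar> * u x) \<le>
      mean (\<lambda>x. \<epsilon> * \<bar>h i x * h j x\<bar> + 8 * K ^ 3 * of_bool (\<epsilon> < \<bar>h l x\<bar>))"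
  proof (rule mean_mono)
    fix x assume x: "x \<subseteq> E"
    show "\<bar>h i x * h j x\<bar> * u x \<le> \<epsilon> * \<bar>h i x * h j x\<bar> + 8 * K ^ 3 * of_bool (\<epsilon> < \<bar>h l x\<bar>)"
    proof (cases "\<epsilon> < \<bar>h l x\<bar>")
      case True
      have "\<bar>h i x * h j x\<bar> * u x \<le> ((2 * K) * (2 * K)) * (2 * K)"
        unfolding abs_mult using h_le[OF _ x] u[OF x] assms(1-3) K_ge_1
        by (intro mult_mono) (auto intro: order_trans)
      also have "\<dots> = 8 * K ^ 3" by (simp add: power3_eq_cube)
      finally have "\<bar>h i x * h j x\<bar> * u x \<le> 8 * K ^ 3" .
      moreover have "0 \<le> \<epsilon> * \<bar>h i x * h j x\<bar>" using \<epsilon> by simp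
      ultimately show ?thesis using True by simp
    next
      case False
      then have "\<bar>h i x * h j x\<bar> * u x \<le> \<bar>h i x * h j x\<bar> * \<epsilon>"
        using u[OF x] by (intro mult_left_mono) auto
      then show ?thesis using False by (simp add: mult.commute)
    qed
  qed
  also have "\<dots> = \<epsilon> * mean (\<lambda>x. \<bar>h i x * h j x\<bar>) + 8 * K ^ 3 * prob (\<lambda>x. \<epsilon> < \<bar>h l x\<bar>)"
    by (simp add: mean_add mean_cmult)
  also have "\<dots> \<le> \<epsilon> * V + 8 * K ^ 3 * r"
    using \<epsilon> K_ge_1 assms by (intro add_mono mult_left_mono mean_abs_hh bad) auto
  finally show ?thesis .
qed

text \<open>The first order expansion is used with G = h e. Its linear terms are correlations of h e
  with q j, that is, p(1 - p) times those of h e with h j up to a cubic remainder. Together with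
  \<open>F' p\<close> this gives the contraction factor 1 - \<delta>, while the cubic terms are at
  most \<epsilon> V + O(r).\<close>

lemma V_le: "V \<le> 44 * K ^ 4 / \<delta> * r"
proof -
  let ?s = "p * (1 - p)"
  have s: "0 \<le> ?s" "?s \<le> 1" using p_bounds by (auto intro: mult_le_one)
  have V1: "mean (\<lambda>x. (h e x)\<^sup>2) \<le>
    F' p * (?s * V + (\<epsilon> * V + 8 * K ^ 3 * r)) +
      K * ((\<epsilon> * V + 8 * K ^ 3 * r) + (2 * K + 1) * (K * r) + K * r) + K * r * (2 * K)"
    if e: "e \<in> E" for e
  proof -
    have Y: "\<bar>mean (\<lambda>x. h e x * q j x)\<bar> \<le> ?s * V + (\<epsilon> * V + 8 * K ^ 3 * r)" if j: "j \<in> E" for j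
    proof -
      have "\<bar>mean (\<lambda>x. h e x * q j x)\<bar> \<le> mean (\<lambda>x. \<bar>h e x * q j x\<bar>)" by (rule abs_mean_le)
      also have "\<dots> \<le> mean (\<lambda>x. ?s * \<bar>h e x * h j x\<bar> + \<bar>h e x * h j x\<bar> * \<bar>h j x\<bar>)"
      proof (rule mean_mono)
        fix x
        have "\<bar>q j x\<bar> \<le> \<bar>?s * h j x\<bar> + (h j x)\<^sup>2" using q_linear[of j x] by linarith
        also have "\<dots> = ?s * \<bar>h j x\<bar> + \<bar>h j x\<bar> * \<bar>h j x\<bar>"
          unfolding abs_mult[of ?s] abs_of_nonneg[OF s(1)] by (simp add: power2_eq_square)
        finally have "\<bar>h e x\<bar> * \<bar>q j x\<bar> \<le> \<bar>h e x\<bar> * \<dots>" by (intro mult_left_mono) auto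
        then show "\<bar>h e x * q j x\<bar> \<le> ?s * \<bar>h e x * h j x\<bar> + \<bar>h e x * h j x\<bar> * \<bar>h j x\<bar>"
          unfolding abs_mult[of "h e x"] by (simp only: distrib_left mult_ac)
      qed
      also have "\<dots> = ?s * mean (\<lambda>x. \<bar>h e x * h j x\<bar>) + mean (\<lambda>x. \<bar>h e x * h j x\<bar> * \<bar>h j x\<bar>)"
        by (simp add: mean_add mean_cmult)
      also have "\<dots> \<le> ?s * V + (\<epsilon> * V + 8 * K ^ 3 * r)"
        using s e j by (intro add_mono mult_left_mono mean_abs_hh mean_triple[where l = j]) auto
      finally show ?thesis .
    qed
    have W: "mean (\<lambda>x. \<bar>h e x * q j x * q i x\<bar>) \<le> \<epsilon> * V + 8 * K ^ 3 * r" if "i \<in> E" "j \<in> E" for i j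
    proof -
      have "mean (\<lambda>x. \<bar>h e x * q j x * q i x\<bar>) \<le> mean (\<lambda>x. \<bar>h e x * h j x\<bar> * \<bar>q i x\<bar>)"
        unfolding abs_mult by (intro mean_mono mult_mono abs_q_le) auto
      also have "\<dots> \<le> \<epsilon> * V + 8 * K ^ 3 * r"
        using e that abs_q_le by (intro mean_triple[where l = i]) auto
      finally show ?thesis .
    qed
    have infl2: "\<bar>h e (insert i x) * q j (insert i x) - h e x * q j x\<bar> \<le> (2 * K + 1) * (K * r)"
      if "i \<in> E" "j \<in> E" "x \<subseteq> E" for i j x
    proof -
      have "h e (insert i x) * q j (insert i x) - h e x * q j x =
        h e (insert i x) * (q j (insert i x) - q j x) + (field e (insert i x) - field e x) * q j x"
        by (simp add: algebra_simps)
      also have "\<bar>\<dots>\<bar> \<le> \<bar>h e (insert i x)\<bar> * \<bar>q j (insert i x) - q j x\<bar> +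
          \<bar>field e (insert i x) - field e x\<bar> * \<bar>q j x\<bar>"
        using abs_triangle_ineq by (simp flip: abs_mult)
      also have "\<dots> \<le> (2 * K) * (K * r) + (K * r) * 1"
        using that e K_ge_1 r_pos
        by (intro add_mono mult_mono h_le q_influence field_influence abs_q_le_1) auto
      finally show ?thesis by (simp add: algebra_simps)
    qed
    have "\<bar>mean (\<lambda>x. h e x * h e x)\<bar> \<le>
        F' p * (?s * V + (\<epsilon> * V + 8 * K ^ 3 * r)) +
        K * ((\<epsilon> * V + 8 * K ^ 3 * r) + (2 * K + 1) * (K * r) + K * r) + K * r * \<bar>mean (h e)\<bar>"
      using field_influence[OF e]
      by (intro mean_field_first_order e t_eq infl2 Y W) auto
    moreover have "K * r * \<bar>mean (h e)\<bar> \<le> K * r * (2 * K)"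
      using K_ge_1 r_pos h_le[OF e] by (intro mult_left_mono abs_mean_le_const) auto
    ultimately show ?thesis by (simp add: power2_eq_square)
  qed
  have "V \<le> F' p * (?s * V + (\<epsilon> * V + 8 * K ^ 3 * r)) +
      K * ((\<epsilon> * V + 8 * K ^ 3 * r) + (2 * K + 1) * (K * r) + K * r) + K * r * (2 * K)"
    unfolding V_def[symmetric]
    by (subst (1) V_def, subst Max_le_iff) (use finite_E E_nonempty V1 in auto)
  also have "F' p * (?s * V + (\<epsilon> * V + 8 * K ^ 3 * r)) \<le> (1 - \<delta>) * V + K * (\<epsilon> * V + 8 * K ^ 3 * r)"
  proof -
    have "F' p * ?s * V \<le> (1 - \<delta>) * V" using contr V_nonneg by (intro mult_right_mono) auto
    moreover have "F' p * (\<epsilon> * V + 8 * K ^ 3 * r) \<le> K * (\<epsilon> * V + 8 * K ^ 3 * r)"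
      using F'_le[of p] p_bounds \<epsilon> V_nonneg K_ge_1 r_pos by (intro mult_right_mono) auto
    ultimately show ?thesis by (simp add: algebra_simps)
  qed
  \<comment> \<open>16 K^4 collects the contributions of the bad event, 2 K^3 + 4 K^2 those of the
    influence of one edge and of the error in \<open>F_approx\<close>.\<close>
  finally have "V \<le> (1 - \<delta>) * V + 2 * K * \<epsilon> * V + (16 * K ^ 4 + 2 * K ^ 3 + 4 * K\<^sup>2) * r"
    by (simp add: algebra_simps power2_eq_square power3_eq_cube power4_eq_xxxx)
  \<comment> \<open>The condition \<open>4 * K * \<epsilon> \<le> \<delta>\<close> is made for this:
    half of \<delta> V survives.\<close>
  moreover have "2 * K * \<epsilon> * V \<le> \<delta> / 2 * V" using \<epsilon> V_nonneg by (intro mult_right_mono) auto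
  moreover have "(16 * K ^ 4 + 2 * K ^ 3 + 4 * K\<^sup>2) * r \<le> (20 * K ^ 4 + 2 * K ^ 4) * r"
  proof (intro mult_right_mono)
    have "K ^ 3 \<le> K ^ 4" "K\<^sup>2 \<le> K ^ 4" using K_ge_1 by (auto intro: power_increasing)
    then show "16 * K ^ 4 + 2 * K ^ 3 + 4 * K\<^sup>2 \<le> 20 * K ^ 4 + 2 * K ^ 4" by linarith
  qed (use r_pos in auto)
  ultimately have "\<delta> / 2 * V \<le> 22 * K ^ 4 * r" by (simp add: algebra_simps)
  then show ?thesis using \<delta> by (simp add: field_simps)
qed

text \<open>With the constant G = 1 the nonlinear errors are of size V and not its square root,
  hence the rate r. The inequality closes for Y, the largest modulus of the mean of q e.\<close>

lemma mean_mem_approx: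
  assumes "e \<in> E"
  shows "\<bar>mean (\<lambda>x. of_bool (e \<in> x)) - p\<bar> \<le> (88 * K ^ 5 / \<delta> + 3 * K\<^sup>2) / \<delta> * r"
proof -
  let ?s = "p * (1 - p)"
  have s: "0 \<le> ?s" "?s \<le> 1" using p_bounds by (auto intro: mult_le_one)
  define Y where "Y = Max ((\<lambda>e. \<bar>mean (q e)\<bar>) ` E)"
  have Y: "\<bar>mean (q j)\<bar> \<le> Y" if "j \<in> E" for j
    unfolding Y_def using that finite_E by (intro Max_ge) auto
  have Y_nonneg: "0 \<le> Y" using Y[OF assms] by linarith
  have bound: "\<bar>mean (q j)\<bar> \<le> (1 - \<delta>) * Y + (K * (V + K * r) + K * r) + V" if j: "j \<in> E" for j
  proof -
    have qq: "mean (\<lambda>x. \<bar>1 * q j x * q i x\<bar>) \<le> V" if "i \<in> E" "j \<in> E" for i j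
    proof -
      have "mean (\<lambda>x. \<bar>1 * q j x * q i x\<bar>) \<le> mean (\<lambda>x. \<bar>h j x * h i x\<bar>)"
        unfolding abs_mult by (intro mean_mono mult_mono) (auto intro: abs_q_le)
      then show ?thesis using mean_abs_hh[of j i] that by linarith
    qed
    \<comment> \<open>The factor 1 and the summand 0 exhibit the constant G and its vanishing
      influence.\<close>
    have "\<bar>mean (\<lambda>x. h j x * 1)\<bar> \<le> F' p * Y + K * (V + K * r + 0) + K * r * \<bar>mean (\<lambda>_. 1)\<bar>"
      using q_influence Y by (intro mean_field_first_order j t_eq qq) auto
    then have h: "\<bar>mean (h j)\<bar> \<le> F' p * Y + K * (V + K * r) + K * r" by simp
    have "\<bar>mean (q j) - ?s * mean (h j)\<bar> \<le> mean (\<lambda>x. \<bar>q j x - ?s * h j x\<bar>)"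
      unfolding mean_cmult[symmetric] mean_diff[symmetric] by (rule abs_mean_le)
    also have "\<dots> \<le> mean (\<lambda>x. (h j x)\<^sup>2)" by (intro mean_mono q_linear)
    finally have "\<bar>mean (q j) - ?s * mean (h j)\<bar> \<le> V" using V_ge[OF j] by linarith
    moreover have "\<bar>?s * mean (h j)\<bar> \<le> ?s * (F' p * Y + (K * (V + K * r) + K * r))"
      unfolding abs_mult[of ?s] abs_of_nonneg[OF s(1)] using h s
      by (intro mult_left_mono) (auto simp: add.assoc)
    moreover have "?s * (F' p * Y + (K * (V + K * r) + K * r)) \<le> (1 - \<delta>) * Y + 1 * (K * (V + K * r) + K * r)"
    proof -
      have "F' p * ?s * Y \<le> (1 - \<delta>) * Y" using contr Y_nonneg by (intro mult_right_mono)
      moreover have "?s * (K * (V + K * r) + K * r) \<le> 1 * (K * (V + K * r) + K * r)"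
        using s V_nonneg K_ge_1 r_pos by (intro mult_right_mono) auto
      ultimately show ?thesis by (simp add: distrib_left mult_ac)
    qed
    moreover have "\<lbrakk>\<bar>x - a\<bar> \<le> v; \<bar>a\<bar> \<le> b; b \<le> y + 1 * k\<rbrakk> \<Longrightarrow> \<bar>x\<bar> \<le> y + k + v"
      for x a b v y k :: real by linarith
    ultimately show ?thesis by blast
  qed
  have "Y \<le> (1 - \<delta>) * Y + (K * (V + K * r) + K * r) + V"
    by (subst (1) Y_def, subst Max_le_iff) (use finite_E E_nonempty bound in auto)
  then have "\<delta> * Y \<le> (K + 1) * V + (K\<^sup>2 + K) * r" by (simp add: algebra_simps power2_eq_square)
  also have "\<dots> \<le> (2 * K) * V + (3 * K\<^sup>2) * r"
    using K_ge_1 V_nonneg r_pos by (intro add_mono mult_right_mono) (auto simp: power2_eq_square)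
  also have "\<dots> \<le> (2 * K) * (44 * K ^ 4 / \<delta> * r) + (3 * K\<^sup>2) * r"
    using V_le K_ge_1 by (intro add_mono mult_left_mono) auto
  also have "\<dots> = (88 * K ^ 5 / \<delta> + 3 * K\<^sup>2) * r"
    by (simp add: algebra_simps eval_nat_numeral)
  finally have Y_le: "Y \<le> (88 * K ^ 5 / \<delta> + 3 * K\<^sup>2) / \<delta> * r"
    using \<delta> by (simp add: pos_le_divide_eq mult.commute)
  have "mean (\<lambda>x. of_bool (e \<in> x)) = mean (\<lambda>x. logistic (field e x))"
    using mean_of_mem[OF assms, of "\<lambda>_. 1"] by simp
  then have "mean (\<lambda>x. of_bool (e \<in> x)) - p = mean (q e)"
    unfolding q_def mean_diff by simp
  then show ?thesis using Y[OF assms] Y_le by simp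
qed

end

end

end

section \<open>Counting embeddings through given edges\<close>

definition pairs :: "nat \<Rightarrow> nat set set" where
  "pairs n = {e. e \<subseteq> {1..n} \<and> card e = 2}"

definition embeddings :: "'v sgraph \<Rightarrow> nat \<Rightarrow> ('v \<Rightarrow> nat) set" where
  "embeddings H n = {\<phi> \<in> verts H \<rightarrow>\<^sub>E {1..n}. inj_on \<phi> (verts H)}"

abbreviation img :: "'v sgraph \<Rightarrow> ('v \<Rightarrow> nat) \<Rightarrow> nat set set" where
  "img H \<phi> \<equiv> (`) \<phi> ` edges H"

lemma finite_pairs: "finite (pairs n)"
  by (rule finite_subset[of _ "Pow {1..n}"]) (auto simp: pairs_def)

lemma card_pairs: "card (pairs n) = n choose 2"
  using n_subsets[of "{1..n}" 2] by (simp add: pairs_def)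

lemma finite_edges:
  assumes "simple_graph H"
  shows "finite (edges H)"
  using assms by (intro finite_subset[of "edges H" "Pow (verts H)"]) (auto simp: simple_graph_def)

lemma finite_embeddings:
  assumes "simple_graph H"
  shows "finite (embeddings H n)"
proof -
  have "finite (verts H \<rightarrow>\<^sub>E {1..n})"
    using assms by (intro finite_PiE) (auto simp: simple_graph_def)
  then show ?thesis by (rule rev_finite_subset) (auto simp: embeddings_def)
qed

lemma inj_on_image_edges:
  assumes "simple_graph H" "\<phi> \<in> embeddings H n"
  shows "inj_on ((`) \<phi>) (edges H)"
proof (rule inj_on_subset)
  show "inj_on ((`) \<phi>) (Pow (verts H))"
    using assms by (intro inj_on_image_Pow) (simp add: embeddings_def)
  show "edges H \<subseteq> Pow (verts H)" using assms by (auto simp: simple_graph_def)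
qed

lemma img_subset_pairs:
  assumes "simple_graph H" "\<phi> \<in> embeddings H n"
  shows "img H \<phi> \<subseteq> pairs n"
proof
  fix e assume "e \<in> img H \<phi>"
  then obtain d where d: "d \<in> edges H" "e = \<phi> ` d" by auto
  have dv: "d \<subseteq> verts H" "card d = 2" using d assms by (auto simp: simple_graph_def)
  have "card (\<phi> ` d) = 2"
    using assms dv by (subst card_image) (auto simp: embeddings_def intro: inj_on_subset)
  moreover have "\<phi> ` d \<subseteq> {1..n}" using assms dv by (auto simp: embeddings_def)
  ultimately show "e \<in> pairs n" by (simp add: pairs_def d)
qed

lemma card_img_minus:
  assumes "simple_graph H" "\<phi> \<in> embeddings H n" "e \<in> img H \<phi>"
  shows "card (img H \<phi> - {e}) = num_edges H - 1"
  using assms inj_on_image_edges[OF assms(1,2)] finite_edges[OF assms(1)]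
  by (simp add: card_Diff_singleton card_image num_edges_def)

lemma card_PiE_fixed_le:
  assumes "finite V" "Y \<subseteq> V" "1 \<le> n"
  shows "real (card {\<phi> \<in> V \<rightarrow>\<^sub>E {1..n}. \<forall>y\<in>Y. \<phi> y = g y}) \<le> real n ^ card V / real n ^ card Y"
proof -
  \<comment> \<open>Only an inclusion, because \<open>g y\<close> may lie outside {1..n}.\<close>
  have "{\<phi> \<in> V \<rightarrow>\<^sub>E {1..n}. \<forall>y\<in>Y. \<phi> y = g y} \<subseteq> PiE V (\<lambda>z. if z \<in> Y then {g z} else {1..n})"
    by (auto simp: PiE_iff extensional_def)
  then have "card {\<phi> \<in> V \<rightarrow>\<^sub>E {1..n}. \<forall>y\<in>Y. \<phi> y = g y} \<le>
      card (PiE V (\<lambda>z. if z \<in> Y then {g z} else {1..n}))"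
    using assms by (intro card_mono finite_PiE) auto
  also have "\<dots> = (\<Prod>z\<in>V. if z \<in> Y then 1 else n)"
    using assms by (subst card_PiE) (auto intro!: prod.cong)
  also have "\<dots> = n ^ (card V - card Y)"
  proof -
    have "V \<inter> - Y = V - Y" by auto
    then show ?thesis
      using assms finite_subset[OF assms(2,1)] by (simp add: prod.If_cases card_Diff_subset)
  qed
  finally have "real (card {\<phi> \<in> V \<rightarrow>\<^sub>E {1..n}. \<forall>y\<in>Y. \<phi> y = g y}) \<le> real n ^ (card V - card Y)"
    by (simp only: of_nat_le_iff of_nat_power[symmetric])
  also have "\<dots> = real n ^ card V / real n ^ card Y"
    using assms by (intro power_diff card_mono) auto
  finally show ?thesis .
qed

text \<open>The factor n - 2 - k loses at most the proportion (k + 2)/n of n, and these losses add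
  up to less than (m + 2)^2 / n. Small n need no separate treatment, since truncated subtraction
  only increases the factors.\<close>

lemma prod_falling_ge:
  assumes "1 \<le> n"
  shows "real n ^ m * (1 - (real m + 2)\<^sup>2 / real n) \<le> real (\<Prod>k<m. n - 2 - k)"
proof (induction m)
  case 0
  show ?case by simp
next
  case (Suc m)
  let ?P = "real (\<Prod>k<m. n - 2 - k)"
  have "(\<Prod>k<m. n - 2 - k) \<le> (\<Prod>k<m. n)" by (intro prod_mono) auto
  then have "(\<Prod>k<m. n - 2 - k) \<le> n ^ m" by simp
  then have P: "?P \<le> real n ^ m" by (simp only: of_nat_le_iff of_nat_power[symmetric])
  \<comment> \<open>Uses (m + 3)^2 - (m + 2)^2 >= m + 2.\<close>
  have "real n ^ Suc m * (1 - (real (Suc m) + 2)\<^sup>2 / real n) \<le>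
      real n * (real n ^ m * (1 - (real m + 2)\<^sup>2 / real n)) - (real m + 2) * real n ^ m"
    using assms by (simp add: field_simps power2_eq_square)
  also have "\<dots> \<le> real n * ?P - (real m + 2) * ?P"
    using assms Suc P by (intro diff_mono mult_left_mono) auto
  also have "\<dots> = (real n - 2 - real m) * ?P" by (simp add: algebra_simps)
  also have "\<dots> \<le> real (n - 2 - m) * ?P" by (intro mult_right_mono of_nat_0_le_iff) auto
  also have "\<dots> = real (\<Prod>k<Suc m. n - 2 - k)" by simp
  finally show ?case .
qed

lemma card_embeddings_fixed_pair_le:
  assumes H: "simple_graph H" and d: "{u, w} \<in> edges H" "u \<noteq> w" and n: "1 \<le> n"
  shows "real (card {\<phi> \<in> embeddings H n. \<phi> u = a \<and> \<phi> w = b}) * (real n)\<^sup>2 / real n ^ card (verts H) \<le> 1"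
proof -
  let ?V = "verts H" and ?S = "{\<phi> \<in> embeddings H n. \<phi> u = a \<and> \<phi> w = b}"
  have V: "finite ?V" "u \<in> ?V" "w \<in> ?V" using H d by (auto simp: simple_graph_def)
  have "real (card ?S) \<le> real (card {\<phi> \<in> ?V \<rightarrow>\<^sub>E {1..n}. \<forall>y\<in>{u, w}. \<phi> y = (if y = u then a else b)})"
    using V d by (intro of_nat_mono card_mono finite_subset[OF _ finite_PiE[of ?V "\<lambda>_. {1..n}"]])
      (auto simp: embeddings_def)
  also have "\<dots> \<le> real n ^ card ?V / real n ^ card {u, w}"
    using V n by (intro card_PiE_fixed_le) auto
  finally show ?thesis using d n by (simp add: field_simps power2_eq_square)
qed

text \<open>The upper bound forgets injectivity. The lower bound counts the injections of the
  remaining vertices into the points other than a and b, each of which extends to an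
  embedding.\<close>

lemma card_embeddings_fixed_pair:
  assumes H: "simple_graph H" and d: "{u, w} \<in> edges H" "u \<noteq> w"
    and ab: "a \<noteq> b" "a \<in> {1..n}" "b \<in> {1..n}" and n: "1 \<le> n"
  shows "\<bar>real (card {\<phi> \<in> embeddings H n. \<phi> u = a \<and> \<phi> w = b}) * (real n)\<^sup>2 / real n ^ card (verts H) - 1\<bar>
    \<le> (real (card (verts H)))\<^sup>2 / real n"
proof -
  let ?V = "verts H" and ?S = "{\<phi> \<in> embeddings H n. \<phi> u = a \<and> \<phi> w = b}"
  let ?U = "?V - {u, w}" and ?W = "{1..n} - {a, b}"
  have V: "finite ?V" "u \<in> ?V" "w \<in> ?V" using H d by (auto simp: simple_graph_def)
  define v where "v = card ?V"
  have v2: "2 \<le> v"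
    using card_mono[of ?V "{u, w}"] V d by (simp add: v_def)
  have cU: "card ?U = v - 2" using V d by (simp add: v_def card_Diff_subset)
  have cW: "card ?W = n - 2" using ab by (simp add: card_Diff_subset)
  have "(\<Prod>k<v - 2. n - 2 - k) = card {\<psi> \<in> ?U \<rightarrow>\<^sub>E ?W. inj_on \<psi> ?U}"
  proof -
    have "card {\<psi> \<in> ?U \<rightarrow>\<^sub>E ?W. inj_on \<psi> ?U} =
        card ?W ^ (card ?U - card ?U) * prod ((-) (card ?W)) {0..<card ?U}"
      using V by (intro card_inj_on_subset_funcset) auto
    then show ?thesis unfolding cU cW by (simp add: atLeast0LessThan)
  qed
  also have "\<dots> \<le> card ?S"
  proof (rule card_inj_on_le)
    let ?ext = "\<lambda>\<psi>. (\<psi>(u := a, w := b)) :: _ \<Rightarrow> nat"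
    show "inj_on ?ext {\<psi> \<in> ?U \<rightarrow>\<^sub>E ?W. inj_on \<psi> ?U}"
    proof (rule inj_onI)
      fix \<psi> \<psi>' assume \<psi>: "\<psi> \<in> {\<psi> \<in> ?U \<rightarrow>\<^sub>E ?W. inj_on \<psi> ?U}" "\<psi>' \<in> {\<psi> \<in> ?U \<rightarrow>\<^sub>E ?W. inj_on \<psi> ?U}"
        and eq: "?ext \<psi> = ?ext \<psi>'"
      show "\<psi> = \<psi>'"
      proof (rule PiE_ext[of \<psi> ?U "\<lambda>_. ?W"])
        fix z assume "z \<in> ?U"
        then show "\<psi> z = \<psi>' z" using fun_cong[OF eq, of z] by (simp split: if_splits)
      qed (use \<psi> in auto)
    qed
    show "?ext ` {\<psi> \<in> ?U \<rightarrow>\<^sub>E ?W. inj_on \<psi> ?U} \<subseteq> ?S"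
    proof (rule image_subsetI)
      fix \<psi> assume \<psi>: "\<psi> \<in> {\<psi> \<in> ?U \<rightarrow>\<^sub>E ?W. inj_on \<psi> ?U}"
      have "?ext \<psi> \<in> ?V \<rightarrow>\<^sub>E {1..n}"
        using \<psi> ab V by (auto simp: PiE_iff extensional_def split: if_splits)
      moreover have "inj_on (?ext \<psi>) ?V"
      proof (rule inj_onI)
        fix y z assume yz: "y \<in> ?V" "z \<in> ?V" "?ext \<psi> y = ?ext \<psi> z"
        have new: "\<psi> x \<noteq> a" "\<psi> x \<noteq> b" if "x \<in> ?U" for x using \<psi> that by auto
        have inj: "\<psi> y = \<psi> z \<Longrightarrow> y \<in> ?U \<Longrightarrow> z \<in> ?U \<Longrightarrow> y = z"
          using \<psi> by (auto dest: inj_onD)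
        consider "y = u" | "y = w" | "y \<in> ?U" using yz by blast
        then show "y = z"
        proof cases
          case 1
          then show ?thesis using yz new[of z] ab d by (auto split: if_splits)
        next
          case 2
          then show ?thesis using yz new[of z] ab d by (auto split: if_splits)
        next
          case 3
          then show ?thesis using yz new[of y] inj ab d by (auto split: if_splits)
        qed
      qed
      ultimately show "?ext \<psi> \<in> ?S" using d by (simp add: embeddings_def)
    qed
    show "finite ?S" using finite_embeddings[OF H] by simp
  qed
  finally have "real (\<Prod>k<v - 2. n - 2 - k) \<le> real (card ?S)" by (simp only: of_nat_le_iff)
  then have lo: "real n ^ (v - 2) * (1 - (real (v - 2) + 2)\<^sup>2 / real n) \<le> real (card ?S)"
    using prod_falling_ge[OF n, of "v - 2"] by linarith
  have "real n ^ (v - 2) = real n ^ v / (real n)\<^sup>2" using n v2 by (simp add: power_diff)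
  then have lo': "real n ^ v / (real n)\<^sup>2 * (1 - (real v)\<^sup>2 / real n) \<le> real (card ?S)"
    using lo v2 by (simp only: of_nat_diff) simp
  have pos: "0 < (real n)\<^sup>2 / real n ^ v" using n by simp
  have "real n ^ v / (real n)\<^sup>2 * ((real n)\<^sup>2 / real n ^ v) = 1" using n by simp
  then have "1 - (real v)\<^sup>2 / real n \<le> real (card ?S) * ((real n)\<^sup>2 / real n ^ v)"
    using mult_right_mono[OF lo', of "(real n)\<^sup>2 / real n ^ v"] pos by (auto simp: mult_ac)
  moreover have "real (card ?S) * ((real n)\<^sup>2 / real n ^ v) \<le> 1"
    using card_embeddings_fixed_pair_le[OF H d n, of a b] by (simp add: v_def)
  moreover have "0 \<le> (real v)\<^sup>2 / real n" by simp
  ultimately show ?thesis by (simp add: v_def abs_le_iff)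
qed

text \<open>These are the copies of H that adding or deleting the pair e can affect.\<close>

definition rooted :: "'v sgraph \<Rightarrow> nat \<Rightarrow> nat set \<Rightarrow> ('v \<Rightarrow> nat) set" where
  "rooted H n e = {\<phi> \<in> embeddings H n. e \<in> img H \<phi>}"

text \<open>By injectivity exactly one edge of H is mapped onto e, in one of two orientations, each
  with about n^(v - 2) extensions. The orientations are the origin of the factor 2 in 2 \<Phi>. The
  first bound carries no error term, and so neither does \<open>F'_bound\<close>.\<close>

lemma card_rooted:
  assumes H: "simple_graph H" and e: "e \<in> pairs n" and n: "1 \<le> n"
  shows "real (card (rooted H n e)) * (real n)\<^sup>2 / real n ^ card (verts H) \<le> 2 * real (num_edges H)"
    and "\<bar>real (card (rooted H n e)) * (real n)\<^sup>2 / real n ^ card (verts H) - 2 * real (num_edges H)\<bar>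
      \<le> 2 * real (num_edges H) * (real (card (verts H)))\<^sup>2 / real n"
proof -
  obtain a b where ab: "e = {a, b}" "a \<noteq> b" using e by (auto simp: pairs_def card_2_iff)
  have abn: "a \<in> {1..n}" "b \<in> {1..n}" using e ab by (auto simp: pairs_def)
  define R where "R d = {\<phi> \<in> embeddings H n. \<phi> ` d = e}" for d
  define \<kappa> where "\<kappa> = (real n)\<^sup>2 / real n ^ card (verts H)"
  have fin: "finite (embeddings H n)" by (rule finite_embeddings[OF H])
  have R: "real (card (R d)) * \<kappa> \<le> 2 \<and>
      \<bar>real (card (R d)) * \<kappa> - 2\<bar> \<le> 2 * (real (card (verts H)))\<^sup>2 / real n"
    if d: "d \<in> edges H" for d
  proof -
    obtain u w where uw: "d = {u, w}" "u \<noteq> w"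
      using H d by (auto simp: simple_graph_def card_2_iff)
    let ?S = "\<lambda>a b. {\<phi> \<in> embeddings H n. \<phi> u = a \<and> \<phi> w = b}"
    have "R d = ?S a b \<union> ?S b a" using ab by (auto simp: R_def uw doubleton_eq_iff)
    moreover have "?S a b \<inter> ?S b a = {}" using ab by auto
    ultimately have "card (R d) = card (?S a b) + card (?S b a)"
      using fin by (simp add: card_Un_disjoint)
    then have "real (card (R d)) * \<kappa> = real (card (?S a b)) * \<kappa> + real (card (?S b a)) * \<kappa>"
      by (simp add: distrib_right)
    moreover have "real (card (?S a b)) * \<kappa> \<le> 1" "real (card (?S b a)) * \<kappa> \<le> 1"
      using card_embeddings_fixed_pair_le[OF H, of u w n] d uw n by (auto simp: \<kappa>_def)
    moreover have "\<bar>real (card (?S a b)) * \<kappa> - 1\<bar> \<le> (real (card (verts H)))\<^sup>2 / real n"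
      "\<bar>real (card (?S b a)) * \<kappa> - 1\<bar> \<le> (real (card (verts H)))\<^sup>2 / real n"
      using card_embeddings_fixed_pair[OF H, of u w _ _ n] d uw n ab abn by (auto simp: \<kappa>_def)
    ultimately show ?thesis by simp
  qed
  have "rooted H n e = (\<Union>d\<in>edges H. R d)" by (auto simp: rooted_def R_def)
  moreover have "card (\<Union>d\<in>edges H. R d) = (\<Sum>d\<in>edges H. card (R d))"
  proof (rule card_UN_disjoint)
    show "\<forall>d\<in>edges H. \<forall>d'\<in>edges H. d \<noteq> d' \<longrightarrow> R d \<inter> R d' = {}"
    proof (intro ballI impI)
      fix d d' assume dd: "d \<in> edges H" "d' \<in> edges H" "d \<noteq> d'"
      have False if "\<phi> \<in> R d" "\<phi> \<in> R d'" for \<phi>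
        using that dd inj_on_image_edges[OF H, of \<phi> n] inj_onD[of "(`) \<phi>" "edges H" d d']
        by (simp add: R_def)
      then show "R d \<inter> R d' = {}" by blast
    qed
  qed (use finite_edges[OF H] fin in \<open>auto simp: R_def\<close>)
  ultimately have eq: "real (card (rooted H n e)) * \<kappa> = (\<Sum>d\<in>edges H. real (card (R d)) * \<kappa>)"
    by (simp add: sum_distrib_right)
  have "(\<Sum>d\<in>edges H. real (card (R d)) * \<kappa>) \<le> (\<Sum>d\<in>edges H. 2)" using R by (intro sum_mono) auto
  then show "real (card (rooted H n e)) * (real n)\<^sup>2 / real n ^ card (verts H) \<le> 2 * real (num_edges H)"
    using eq by (simp add: \<kappa>_def num_edges_def)
  have "real (card (rooted H n e)) * \<kappa> - 2 * real (num_edges H) = (\<Sum>d\<in>edges H. real (card (R d)) * \<kappa> - 2)"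
    by (simp add: eq sum_subtractf num_edges_def)
  also have "\<bar>\<dots>\<bar> \<le> (\<Sum>d\<in>edges H. 2 * (real (card (verts H)))\<^sup>2 / real n)"
    using R by (intro order_trans[OF sum_abs] sum_mono) blast
  finally show "\<bar>real (card (rooted H n e)) * (real n)\<^sup>2 / real n ^ card (verts H) - 2 * real (num_edges H)\<bar>
      \<le> 2 * real (num_edges H) * (real (card (verts H)))\<^sup>2 / real n"
    by (simp add: \<kappa>_def num_edges_def mult_ac)
qed

text \<open>Two distinct pairs span at least three points, which costs a factor of \<open>n\<close> compared
  with \<open>card_rooted\<close>.\<close>

lemma card_rooted2_le:
  assumes H: "simple_graph H" and e: "e \<in> pairs n" and j: "j \<in> pairs n" "j \<noteq> e" and n: "1 \<le> n"
  shows "real (card {\<phi> \<in> rooted H n e. j \<in> img H \<phi>}) * (real n)\<^sup>2 / real n ^ card (verts H)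
    \<le> real (card (verts H)) ^ 3 / real n"
proof -
  let ?V = "verts H"
  have V: "finite ?V" using H by (simp add: simple_graph_def)
  obtain a b where ab: "e = {a, b}" "a \<noteq> b" using e by (auto simp: pairs_def card_2_iff)
  obtain c where c: "c \<in> j" "c \<notin> e"
  proof -
    have "\<not> j \<subseteq> e"
    proof
      assume "j \<subseteq> e"
      moreover have "finite e" using ab by simp
      ultimately have "j = e" using e j by (intro card_subset_eq) (auto simp: pairs_def)
      then show False using j by simp
    qed
    then show thesis using that by blast
  qed
  \<comment> \<open>Preimages of a, b and c are chosen among the vertices of H, which gives the
    factor v^3.\<close>
  let ?F = "\<lambda>(y1, y2, y3). {\<phi> \<in> embeddings H n. \<phi> y1 = a \<and> \<phi> y2 = b \<and> \<phi> y3 = c}"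
  have "{\<phi> \<in> rooted H n e. j \<in> img H \<phi>} \<subseteq> (\<Union>y\<in>?V \<times> ?V \<times> ?V. ?F y)"
  proof
    fix \<phi> assume \<phi>: "\<phi> \<in> {\<phi> \<in> rooted H n e. j \<in> img H \<phi>}"
    have sub: "k \<subseteq> \<phi> ` ?V" if k: "k \<in> img H \<phi>" for k
    proof -
      obtain d where "d \<in> edges H" "k = \<phi> ` d" using k by blast
      then show ?thesis using H by (auto simp: simple_graph_def)
    qed
    have "a \<in> \<phi> ` ?V" "b \<in> \<phi> ` ?V" "c \<in> \<phi> ` ?V"
      using sub[of e] sub[of j] \<phi> ab c by (auto simp: rooted_def)
    then obtain y1 y2 y3 where "y1 \<in> ?V" "y2 \<in> ?V" "y3 \<in> ?V" "\<phi> y1 = a" "\<phi> y2 = b" "\<phi> y3 = c"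
      by blast
    then show "\<phi> \<in> (\<Union>y\<in>?V \<times> ?V \<times> ?V. ?F y)" using \<phi> by (auto simp: rooted_def)
  qed
  then have "card {\<phi> \<in> rooted H n e. j \<in> img H \<phi>} \<le> card (\<Union>y\<in>?V \<times> ?V \<times> ?V. ?F y)"
    using V finite_embeddings[OF H] by (intro card_mono) auto
  also have "\<dots> \<le> (\<Sum>y\<in>?V \<times> ?V \<times> ?V. card (?F y))" using V by (intro card_UN_le) auto
  finally have "real (card {\<phi> \<in> rooted H n e. j \<in> img H \<phi>}) \<le> (\<Sum>y\<in>?V \<times> ?V \<times> ?V. real (card (?F y)))"
    by (simp only: of_nat_le_iff of_nat_sum[symmetric])
  also have "\<dots> \<le> (\<Sum>y\<in>?V \<times> ?V \<times> ?V. real n ^ card ?V / real n ^ 3)"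
  proof (rule sum_mono)
    fix y assume "y \<in> ?V \<times> ?V \<times> ?V"
    then obtain y1 y2 y3 where y: "y = (y1, y2, y3)" "y1 \<in> ?V" "y2 \<in> ?V" "y3 \<in> ?V" by auto
    show "real (card (?F y)) \<le> real n ^ card ?V / real n ^ 3"
    proof (cases "y1 = y2 \<or> y1 = y3 \<or> y2 = y3")
      case True
      then have "?F y = {}" using ab c y by auto
      then show ?thesis by simp
    next
      case False
      have "real (card (?F y)) \<le> real (card {\<phi> \<in> ?V \<rightarrow>\<^sub>E {1..n}.
          \<forall>z\<in>{y1, y2, y3}. \<phi> z = (if z = y1 then a else if z = y2 then b else c)})"
        using V y False by (intro of_nat_mono card_mono finite_subset[OF _ finite_PiE[of ?V "\<lambda>_. {1..n}"]])
          (auto simp: embeddings_def)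
      also have "\<dots> \<le> real n ^ card ?V / real n ^ card {y1, y2, y3}"
        using V y n by (intro card_PiE_fixed_le) auto
      finally show ?thesis using False by (simp add: power3_eq_cube mult.assoc)
    qed
  qed
  also have "\<dots> = real (card ?V) ^ 3 * (real n ^ card ?V / real n ^ 3)"
    by (simp add: card_cartesian_product power3_eq_cube)
  finally have "real (card {\<phi> \<in> rooted H n e. j \<in> img H \<phi>}) * ((real n)\<^sup>2 / real n ^ card ?V) \<le>
      real (card ?V) ^ 3 * (real n ^ card ?V / real n ^ 3) * ((real n)\<^sup>2 / real n ^ card ?V)"
    by (intro mult_right_mono) auto
  also have "\<dots> = real (card ?V) ^ 3 / real n"
    using n by (simp add: power2_eq_square power3_eq_cube)
  finally show ?thesis by simp
qed

section \<open>The ERGM as a mean field Gibbs measure\<close>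

definition energy :: "('m::finite \<Rightarrow> 'v sgraph) \<Rightarrow> nat \<Rightarrow> real ^ 'm \<Rightarrow> nat set set \<Rightarrow> real" where
  "energy H n \<beta> x = (real n)\<^sup>2 * (\<Sum>i\<in>UNIV. \<beta> $ i * hom_density (H i) (SGraph {1..n} x))"

definition rooted_all :: "('m::finite \<Rightarrow> 'v sgraph) \<Rightarrow> nat \<Rightarrow> nat set \<Rightarrow> ('m \<times> ('v \<Rightarrow> nat)) set" where
  "rooted_all H n e = (SIGMA i:UNIV. rooted (H i) n e)"

definition coef :: "('m::finite \<Rightarrow> 'v sgraph) \<Rightarrow> nat \<Rightarrow> real ^ 'm \<Rightarrow> 'm \<times> ('v \<Rightarrow> nat) \<Rightarrow> real" where
  "coef H n \<beta> = (\<lambda>(i, \<phi>). \<beta> $ i * ((real n)\<^sup>2 / real n ^ card (verts (H i))))"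

definition rest :: "('m::finite \<Rightarrow> 'v sgraph) \<Rightarrow> nat set \<Rightarrow> 'm \<times> ('v \<Rightarrow> nat) \<Rightarrow> nat set set" where
  "rest H e = (\<lambda>(i, \<phi>). img (H i) \<phi> - {e})"

text \<open>The derivative of \<open>ergm_Phi\<close>. Where an exponent truncates, a prefactor
  vanishes.\<close>

definition dPhi :: "('m::finite \<Rightarrow> 'v sgraph) \<Rightarrow> real ^ 'm \<Rightarrow> real \<Rightarrow> real" where
  "dPhi H \<beta> a = (\<Sum>i\<in>UNIV. \<beta> $ i * real (num_edges (H i)) *
     (real (num_edges (H i) - 1) * a ^ (num_edges (H i) - 1 - 1)))"

text \<open>One constant for all conditions of \<open>mean_field\<close>: the cube of the edge
  number covers the size of the field, \<open>card_sq\<close> and \<open>F'\<close>, the cube of the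
  vertex number the influence of one edge, the last summand the error in \<open>F_approx\<close>. It
  depends on the parameter only through the bound b, hence the uniformity.\<close>

definition Kconst :: "('m::finite \<Rightarrow> 'v sgraph) \<Rightarrow> real \<Rightarrow> real" where
  "Kconst H b = 1 + b * (\<Sum>i\<in>UNIV. 2 * real (num_edges (H i)) ^ 3 +
     real (card (verts (H i))) ^ 3 + 2 * real (num_edges (H i)) * (real (card (verts (H i))))\<^sup>2)"

lemma Hom_eq_card: "Hom H (SGraph {1..n} x) = card {\<phi> \<in> embeddings H n. img H \<phi> \<subseteq> x}"
  unfolding Hom_def embeddings_def by (rule arg_cong[where f = card]) auto

text \<open>A copy avoiding e lies in \<open>insert e x\<close> exactly if it lies in
  \<open>x - {e}\<close>, so it cancels. A copy through e never lies in \<open>x - {e}\<close>, and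
  it lies in \<open>insert e x\<close> exactly if its other edges lie in x.\<close>

lemma Hom_insert_minus:
  assumes "simple_graph H"
  shows "real (Hom H (SGraph {1..n} (insert e x))) - real (Hom H (SGraph {1..n} (x - {e}))) =
    (\<Sum>\<phi>\<in>rooted H n e. of_bool (img H \<phi> - {e} \<subseteq> x))"
proof -
  have eq: "real (Hom H (SGraph {1..n} y)) = (\<Sum>\<phi>\<in>embeddings H n. of_bool (img H \<phi> \<subseteq> y))" for y
    unfolding Hom_eq_card using finite_embeddings[OF assms] by (simp add: Int_def)
  have "(\<Sum>\<phi>\<in>rooted H n e. of_bool (img H \<phi> - {e} \<subseteq> x)) =
    (\<Sum>\<phi>\<in>embeddings H n. if e \<in> img H \<phi> then of_bool (img H \<phi> - {e} \<subseteq> x) else (0::real))"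
    unfolding rooted_def by (rule sum.inter_filter) (rule finite_embeddings[OF assms])
  also have "\<dots> = (\<Sum>\<phi>\<in>embeddings H n. of_bool (img H \<phi> \<subseteq> insert e x) - of_bool (img H \<phi> \<subseteq> x - {e}))"
  proof (rule sum.cong)
    fix \<phi>
    define y where "y = img H \<phi>"
    show "(if e \<in> img H \<phi> then of_bool (img H \<phi> - {e} \<subseteq> x) else (0::real)) =
      of_bool (img H \<phi> \<subseteq> insert e x) - of_bool (img H \<phi> \<subseteq> x - {e})"
      unfolding y_def[symmetric] by (cases "e \<in> y"; cases "y - {e} \<subseteq> x") auto
  qed simp
  finally show ?thesis unfolding eq by (simp add: sum_subtractf)
qed

lemma sum_rooted_all:
  assumes "\<And>i. simple_graph (H i)"
  shows "(\<Sum>\<tau>\<in>rooted_all H n e. g \<tau>) = (\<Sum>i\<in>UNIV. \<Sum>\<phi>\<in>rooted (H i) n e. g (i, \<phi>))"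
proof -
  have "finite (rooted (H i) n e)" for i
    using finite_embeddings[OF assms] by (simp add: rooted_def)
  then show ?thesis unfolding rooted_all_def by (subst sum.Sigma) auto
qed

text \<open>All rooted copies of \<open>H i\<close> leave the same number of edges, so only their
  count matters. The function g is later k^2, a^k and k a^(k - 1).\<close>

lemma sum_rooted_card:
  assumes "\<And>i. simple_graph (H i)"
  shows "(\<Sum>\<tau>\<in>rooted_all H n e. coef H n \<beta> \<tau> * g (card (rest H e \<tau>))) =
    (\<Sum>i\<in>UNIV. \<beta> $ i * (real (card (rooted (H i) n e)) * (real n)\<^sup>2 / real n ^ card (verts (H i))) *
      g (num_edges (H i) - 1))"
proof -
  have "(\<Sum>\<phi>\<in>rooted (H i) n e. coef H n \<beta> (i, \<phi>) * g (card (rest H e (i, \<phi>)))) =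
    (\<Sum>\<phi>\<in>rooted (H i) n e. \<beta> $ i * ((real n)\<^sup>2 / real n ^ card (verts (H i))) * g (num_edges (H i) - 1))" for i
  proof (rule sum.cong)
    fix \<phi> assume "\<phi> \<in> rooted (H i) n e"
    then have "card (rest H e (i, \<phi>)) = num_edges (H i) - 1"
      using card_img_minus[OF assms, of \<phi> i n e] by (simp add: rest_def rooted_def)
    then show "coef H n \<beta> (i, \<phi>) * g (card (rest H e (i, \<phi>))) =
        \<beta> $ i * ((real n)\<^sup>2 / real n ^ card (verts (H i))) * g (num_edges (H i) - 1)"
      by (simp add: coef_def)
  qed simp
  then show ?thesis by (simp add: sum_rooted_all[OF assms] mult_ac)
qed

section \<open>Verification of the mean field conditions for bounded parameters\<close>

locale ergm_params =
  fixes H :: "'m::finite \<Rightarrow> 'v sgraph" and i\<^sub>1 :: 'm and \<beta> :: "real ^ 'm" and b :: real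
  assumes simple: "simple_graph (H i)"
    and single: "is_single_edge (H i\<^sub>1)"
    and nonneg: "i \<noteq> i\<^sub>1 \<Longrightarrow> 0 \<le> \<beta> $ i"
    and bounded: "\<bar>\<beta> $ i\<bar> \<le> b"
begin

lemma b_nonneg: "0 \<le> b"
  using bounded[of undefined] by linarith

lemma num_edges_i1: "num_edges (H i\<^sub>1) = 1"
  using single by (auto simp: is_single_edge_def num_edges_def)

lemma sum_le_Kconst:
  assumes "\<And>i. u i \<le> 2 * real (num_edges (H i)) ^ 3 \<or> u i \<le> real (card (verts (H i))) ^ 3 \<or>
      u i \<le> 2 * real (num_edges (H i)) * (real (card (verts (H i))))\<^sup>2"
    and "\<And>i. 0 \<le> u i"
  shows "(\<Sum>i\<in>UNIV. \<bar>\<beta> $ i\<bar> * u i) \<le> Kconst H b - 1"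
proof -
  have "(\<Sum>i\<in>UNIV. \<bar>\<beta> $ i\<bar> * u i) \<le> (\<Sum>i\<in>UNIV. b * (2 * real (num_edges (H i)) ^ 3 +
     real (card (verts (H i))) ^ 3 + 2 * real (num_edges (H i)) * (real (card (verts (H i))))\<^sup>2))"
  proof (intro sum_mono mult_mono)
    fix i
    have "0 \<le> real (num_edges (H i)) ^ 3" "0 \<le> real (card (verts (H i))) ^ 3"
      "0 \<le> 2 * real (num_edges (H i)) * (real (card (verts (H i))))\<^sup>2" by auto
    then show "u i \<le> 2 * real (num_edges (H i)) ^ 3 +
     real (card (verts (H i))) ^ 3 + 2 * real (num_edges (H i)) * (real (card (verts (H i))))\<^sup>2"
      using assms(1)[of i] by linarith
  qed (use bounded b_nonneg assms in auto)
  then show ?thesis by (simp add: Kconst_def sum_distrib_left)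
qed

lemma Kconst_ge_1: "1 \<le> Kconst H b"
  using sum_le_Kconst[of "\<lambda>_. 0"] by simp

lemma edges_cube_bounds:
  "2 * real (num_edges (H i)) \<le> 2 * real (num_edges (H i)) ^ 3"
  "2 * real (num_edges (H i)) * (real (num_edges (H i) - 1))\<^sup>2 \<le> 2 * real (num_edges (H i)) ^ 3"
  "2 * real (num_edges (H i)) * real (num_edges (H i) - 1) \<le> 2 * real (num_edges (H i)) ^ 3"
proof -
  let ?e = "num_edges (H i)"
  have *: "?e \<le> ?e ^ 3" "?e * (?e - 1)\<^sup>2 \<le> ?e ^ 3" "?e * (?e - 1) \<le> ?e ^ 3"
  proof -
    show "?e \<le> ?e ^ 3" by (cases "?e = 0") (auto simp: self_le_power)
    have "(?e - 1)\<^sup>2 \<le> ?e\<^sup>2" by (rule power_mono) auto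
    then have "?e * (?e - 1)\<^sup>2 \<le> ?e * ?e\<^sup>2" by (rule mult_le_mono2)
    then show "?e * (?e - 1)\<^sup>2 \<le> ?e ^ 3" by (simp add: power2_eq_square power3_eq_cube)
    have "?e - 1 \<le> ?e * ?e" by (cases ?e) auto
    then have "?e * (?e - 1) \<le> ?e * (?e * ?e)" by (rule mult_le_mono2)
    then show "?e * (?e - 1) \<le> ?e ^ 3" by (simp add: power3_eq_cube)
  qed
  then have "real ?e \<le> real (?e ^ 3)" "real (?e * (?e - 1)\<^sup>2) \<le> real (?e ^ 3)"
    "real (?e * (?e - 1)) \<le> real (?e ^ 3)"
    by (simp_all only: of_nat_le_iff)
  then show "2 * real ?e \<le> 2 * real ?e ^ 3" "2 * real ?e * (real (?e - 1))\<^sup>2 \<le> 2 * real ?e ^ 3"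
    "2 * real ?e * real (?e - 1) \<le> 2 * real ?e ^ 3"
    unfolding mult.assoc of_nat_mult of_nat_power by linarith+
qed

text \<open>The index \<open>i\<^sub>1\<close> falls under the second premise, as its graph has no
  edge besides the root; for the other indices the coefficient is nonnegative.\<close>

lemma beta_mult_mono:
  assumes "0 < num_edges (H i) - 1 \<Longrightarrow> u \<le> v" "num_edges (H i) - 1 = 0 \<Longrightarrow> u = v"
  shows "\<beta> $ i * u \<le> \<beta> $ i * v"
proof (cases "num_edges (H i) - 1 = 0")
  case True
  then show ?thesis using assms by simp
next
  case False
  then have "i \<noteq> i\<^sub>1" using num_edges_i1 by auto
  then show ?thesis using assms(1) False nonneg by (intro mult_left_mono) auto
qed

lemma dPhi_le: "\<lbrakk>0 \<le> a; a \<le> 1\<rbrakk> \<Longrightarrow> 2 * dPhi H \<beta> a \<le> Kconst H b"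
proof -
  assume a: "0 \<le> a" "a \<le> 1"
  have "2 * dPhi H \<beta> a =
    (\<Sum>i\<in>UNIV. \<beta> $ i * (2 * real (num_edges (H i)) * real (num_edges (H i) - 1) * a ^ (num_edges (H i) - 1 - 1)))"
    by (simp add: dPhi_def sum_distrib_left mult_ac)
  also have "\<dots> \<le> (\<Sum>i\<in>UNIV. \<bar>\<beta> $ i\<bar> * (2 * real (num_edges (H i)) * real (num_edges (H i) - 1) * 1))"
    using a by (intro sum_mono mult_mono power_le_one) auto
  also have "\<dots> \<le> Kconst H b - 1"
    using edges_cube_bounds by (intro sum_le_Kconst) auto
  finally show ?thesis by simp
qed

lemma Phi_le: "\<lbrakk>0 \<le> a; a \<le> 1\<rbrakk> \<Longrightarrow> \<bar>2 * ergm_Phi H \<beta> a\<bar> \<le> Kconst H b - 1"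
proof -
  assume a: "0 \<le> a" "a \<le> 1"
  have "\<bar>2 * ergm_Phi H \<beta> a\<bar> = \<bar>\<Sum>i\<in>UNIV. \<beta> $ i * (2 * real (num_edges (H i)) * a ^ (num_edges (H i) - 1))\<bar>"
    by (simp add: ergm_Phi_def sum_distrib_left mult_ac)
  also have "\<dots> \<le> (\<Sum>i\<in>UNIV. \<bar>\<beta> $ i\<bar> * (2 * real (num_edges (H i)) * 1))"
    using a by (intro order_trans[OF sum_abs] sum_mono)
      (auto simp: abs_mult intro!: mult_left_mono power_le_one mult_left_le)
  also have "\<dots> \<le> Kconst H b - 1"
    using edges_cube_bounds by (intro sum_le_Kconst) auto
  finally show ?thesis .
qed

context
  fixes n :: nat
  assumes n: "2 \<le> n"
begin

interpretation gibbs "pairs n" "energy H n \<beta>"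
  by unfold_locales (rule finite_pairs)

lemma field_energy:
  "field e x = (\<Sum>\<tau>\<in>rooted_all H n e. coef H n \<beta> \<tau> * of_bool (rest H e \<tau> \<subseteq> x))"
proof -
  have "field e x = (\<Sum>i\<in>UNIV. \<beta> $ i * ((real n)\<^sup>2 / real n ^ card (verts (H i))) *
      (real (Hom (H i) (SGraph {1..n} (insert e x))) - real (Hom (H i) (SGraph {1..n} (x - {e})))))"
    unfolding field_def energy_def hom_density_def
    by (simp add: sum_distrib_left sum_subtractf[symmetric] diff_divide_distrib right_diff_distrib mult_ac)
  then show ?thesis
    unfolding Hom_insert_minus[OF simple]
    by (simp add: sum_rooted_all[where H = H, OF simple] coef_def rest_def sum_distrib_left mult_ac)
qed

lemma abs_field_le: "e \<in> pairs n \<Longrightarrow> \<bar>field e x\<bar> \<le> Kconst H b"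
proof -
  assume e: "e \<in> pairs n"
  have "\<bar>field e x\<bar> \<le> (\<Sum>\<tau>\<in>rooted_all H n e. \<bar>coef H n \<beta> \<tau>\<bar>)"
    unfolding field_energy by (intro order_trans[OF sum_abs] sum_mono) (auto simp: abs_mult)
  also have "\<dots> = (\<Sum>i\<in>UNIV. \<bar>\<beta> $ i\<bar> *
      (real (card (rooted (H i) n e)) * (real n)\<^sup>2 / real n ^ card (verts (H i))))"
    by (simp add: sum_rooted_all[where H = H, OF simple] coef_def abs_mult mult_ac)
  also have "\<dots> \<le> Kconst H b - 1"
  proof (rule sum_le_Kconst, intro disjI1)
    fix i
    show "real (card (rooted (H i) n e)) * (real n)\<^sup>2 / real n ^ card (verts (H i)) \<le>
        2 * real (num_edges (H i)) ^ 3"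
      using n card_rooted(1)[OF simple[of i] e] edges_cube_bounds(1)[of i] by linarith
  qed simp
  finally show ?thesis by simp
qed

text \<open>Only copies through both e and j react to j, and they are fewer by a factor of order n.
  For j = e nothing changes, since the field of e does not depend on the presence of e.\<close>

lemma field_influence_le:
  assumes e: "e \<in> pairs n" and j: "j \<in> pairs n"
  shows "\<bar>field e (insert j x) - field e x\<bar> \<le> Kconst H b * (1 / real n)"
proof (cases "j = e")
  case True
  then show ?thesis using Kconst_ge_1 by (simp add: field_def)
next
  case False
  have "field e (insert j x) - field e x = (\<Sum>\<tau>\<in>rooted_all H n e. coef H n \<beta> \<tau> *
      (of_bool (rest H e \<tau> \<subseteq> insert j x) - of_bool (rest H e \<tau> \<subseteq> x)))"
    unfolding field_energy by (simp add: sum_subtractf right_diff_distrib)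
  also have "\<bar>\<dots>\<bar> \<le> (\<Sum>\<tau>\<in>rooted_all H n e. \<bar>coef H n \<beta> \<tau>\<bar> * of_bool (j \<in> rest H e \<tau>))"
    by (intro order_trans[OF sum_abs] sum_mono) (auto simp: abs_mult subset_insert)
  also have "\<dots> = (\<Sum>i\<in>UNIV. \<bar>\<beta> $ i\<bar> * (real (card {\<phi> \<in> rooted (H i) n e. j \<in> img (H i) \<phi>}) *
      (real n)\<^sup>2 / real n ^ card (verts (H i))))"
  proof -
    have fin: "finite (rooted (H i) n e)" for i
      using finite_embeddings[OF simple] by (simp add: rooted_def)
    have "(\<Sum>\<phi>\<in>rooted (H i) n e. \<bar>coef H n \<beta> (i, \<phi>)\<bar> * of_bool (j \<in> rest H e (i, \<phi>))) =
        \<bar>\<beta> $ i\<bar> * ((real n)\<^sup>2 / real n ^ card (verts (H i))) *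
        (\<Sum>\<phi>\<in>rooted (H i) n e. of_bool (j \<in> img (H i) \<phi>))" for i
      unfolding sum_distrib_left
      by (rule sum.cong) (use False in \<open>auto simp: coef_def rest_def abs_mult\<close>)
    moreover have "(\<Sum>\<phi>\<in>rooted (H i) n e. of_bool (j \<in> img (H i) \<phi>)) =
        real (card {\<phi> \<in> rooted (H i) n e. j \<in> img (H i) \<phi>})" for i
      using fin by (simp add: Int_def)
    ultimately show ?thesis by (simp only: sum_rooted_all[where H = H, OF simple]) (simp add: mult_ac)
  qed
  also have "\<dots> \<le> (\<Sum>i\<in>UNIV. \<bar>\<beta> $ i\<bar> * (real (card (verts (H i))) ^ 3 / real n))"
    using n j e False by (intro sum_mono mult_left_mono card_rooted2_le simple) auto
  also have "\<dots> = (\<Sum>i\<in>UNIV. \<bar>\<beta> $ i\<bar> * real (card (verts (H i))) ^ 3) * (1 / real n)"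
    by (simp add: sum_divide_distrib)
  also have "\<dots> \<le> Kconst H b * (1 / real n)"
    using sum_le_Kconst[of "\<lambda>i. real (card (verts (H i))) ^ 3"] by (intro mult_right_mono) auto
  finally show ?thesis .
qed

lemma mean_field_energy:
  "mean_field (pairs n) (energy H n \<beta>) (rooted_all H n) (coef H n \<beta>) (rest H)
     (\<lambda>a. 2 * ergm_Phi H \<beta> a) (\<lambda>a. 2 * dPhi H \<beta> a) (Kconst H b) (1 / real n)"
proof
  show "pairs n \<noteq> {}" using n card_pairs[of n] zero_less_binomial[OF n] by auto
  fix e assume e: "e \<in> pairs n"
  let ?\<kappa> = "\<lambda>i. real (card (rooted (H i) n e)) * (real n)\<^sup>2 / real n ^ card (verts (H i))"
  have \<kappa>: "0 \<le> ?\<kappa> i" "?\<kappa> i \<le> 2 * real (num_edges (H i))"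
    "\<bar>?\<kappa> i - 2 * real (num_edges (H i))\<bar> \<le>
       2 * real (num_edges (H i)) * (real (card (verts (H i))))\<^sup>2 / real n" for i
    using card_rooted[OF simple e] n by auto
  show "rest H e \<tau> \<subseteq> pairs n" if "\<tau> \<in> rooted_all H n e" for \<tau>
  proof -
    obtain i \<phi> where \<tau>: "\<tau> = (i, \<phi>)" "\<phi> \<in> embeddings (H i) n"
      using \<open>\<tau> \<in> rooted_all H n e\<close> by (auto simp: rooted_all_def rooted_def)
    show ?thesis using img_subset_pairs[OF simple \<tau>(2)] by (auto simp: rest_def \<tau>(1))
  qed
  show "rest H e \<tau> = {} \<or> 0 \<le> coef H n \<beta> \<tau>" if "\<tau> \<in> rooted_all H n e" for \<tau>
  proof -
    obtain i \<phi> where \<tau>: "\<tau> = (i, \<phi>)" "\<phi> \<in> embeddings (H i) n" "e \<in> img (H i) \<phi>"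
      using \<open>\<tau> \<in> rooted_all H n e\<close> by (auto simp: rooted_all_def rooted_def)
    show ?thesis
    \<comment> \<open>Removing the root from a copy of the single edge leaves the empty set; all
      other coefficients are nonnegative.\<close>
    proof (cases "i = i\<^sub>1")
      case True
      then have "card (rest H e \<tau>) = 0"
        using card_img_minus[OF simple \<tau>(2,3)] num_edges_i1 by (simp add: rest_def \<tau>)
      moreover have "finite (rest H e \<tau>)" using finite_edges[OF simple] by (simp add: rest_def \<tau>)
      ultimately show ?thesis by (simp only: card_0_eq simp_thms)
    next
      case False
      then show ?thesis using nonneg by (simp add: coef_def \<tau>)
    qed
  qed
  show "\<bar>field e x\<bar> \<le> Kconst H b" for x by (rule abs_field_le[OF e])
  show "field e x = (\<Sum>\<tau>\<in>rooted_all H n e. coef H n \<beta> \<tau> * of_bool (rest H e \<tau> \<subseteq> x))" for x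
    by (rule field_energy)
  show "\<bar>field e (insert j x) - field e x\<bar> \<le> Kconst H b * (1 / real n)" if "j \<in> pairs n" for j x
    by (rule field_influence_le[OF e that])
  show "(\<Sum>\<tau>\<in>rooted_all H n e. coef H n \<beta> \<tau> * (real (card (rest H e \<tau>)))\<^sup>2) \<le> Kconst H b"
  proof -
    have "(\<Sum>\<tau>\<in>rooted_all H n e. coef H n \<beta> \<tau> * (real (card (rest H e \<tau>)))\<^sup>2) =
        (\<Sum>i\<in>UNIV. \<beta> $ i * (?\<kappa> i * (real (num_edges (H i) - 1))\<^sup>2))"
      using sum_rooted_card[where H = H and n = n and e = e and \<beta> = \<beta> and g = "\<lambda>k. (real k)\<^sup>2", OF simple] by (simp add: mult.assoc)
    also have "\<dots> \<le> (\<Sum>i\<in>UNIV. \<bar>\<beta> $ i\<bar> * (2 * real (num_edges (H i)) * (real (num_edges (H i) - 1))\<^sup>2))"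
      using \<kappa> by (intro sum_mono mult_mono) auto
    also have "\<dots> \<le> Kconst H b - 1"
      using edges_cube_bounds by (intro sum_le_Kconst) auto
    finally show ?thesis by simp
  qed
  fix a :: real assume a: "0 \<le> a" "a \<le> 1"
  show "\<bar>(\<Sum>\<tau>\<in>rooted_all H n e. coef H n \<beta> \<tau> * a ^ card (rest H e \<tau>)) - 2 * ergm_Phi H \<beta> a\<bar>
      \<le> Kconst H b * (1 / real n)"
  proof -
    have "(\<Sum>\<tau>\<in>rooted_all H n e. coef H n \<beta> \<tau> * a ^ card (rest H e \<tau>)) - 2 * ergm_Phi H \<beta> a =
        (\<Sum>i\<in>UNIV. \<beta> $ i * (?\<kappa> i - 2 * real (num_edges (H i))) * a ^ (num_edges (H i) - 1))"
      unfolding sum_rooted_card[where H = H and n = n and e = e and \<beta> = \<beta> and g = "\<lambda>k. a ^ k", OF simple] ergm_Phi_def sum_distrib_left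
        sum_subtractf[symmetric]
      by (intro sum.cong) (simp_all add: algebra_simps)
    also have "\<bar>\<dots>\<bar> \<le> (\<Sum>i\<in>UNIV. \<bar>\<beta> $ i\<bar> *
        (2 * real (num_edges (H i)) * (real (card (verts (H i))))\<^sup>2 / real n) * 1)"
    proof (intro order_trans[OF sum_abs] sum_mono)
      fix i
      have "\<bar>\<beta> $ i * (?\<kappa> i - 2 * real (num_edges (H i))) * a ^ (num_edges (H i) - 1)\<bar> =
          \<bar>\<beta> $ i\<bar> * \<bar>?\<kappa> i - 2 * real (num_edges (H i))\<bar> * a ^ (num_edges (H i) - 1)"
        using a by (simp only: abs_mult power_abs abs_of_nonneg)
      also have "\<dots> \<le> \<bar>\<beta> $ i\<bar> *
          (2 * real (num_edges (H i)) * (real (card (verts (H i))))\<^sup>2 / real n) * 1"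
        using a by (intro mult_mono[OF mult_left_mono[OF \<kappa>(3)] power_le_one]) auto
      finally show "\<bar>\<beta> $ i * (?\<kappa> i - 2 * real (num_edges (H i))) * a ^ (num_edges (H i) - 1)\<bar> \<le>
          \<bar>\<beta> $ i\<bar> * (2 * real (num_edges (H i)) * (real (card (verts (H i))))\<^sup>2 / real n) * 1" .
    qed
    also have "\<dots> = (\<Sum>i\<in>UNIV. \<bar>\<beta> $ i\<bar> *
        (2 * real (num_edges (H i)) * (real (card (verts (H i))))\<^sup>2)) * (1 / real n)"
      by (simp add: sum_divide_distrib)
    also have "\<dots> \<le> Kconst H b * (1 / real n)"
      using sum_le_Kconst[of "\<lambda>i. 2 * real (num_edges (H i)) * (real (card (verts (H i))))\<^sup>2"]
      by (intro mult_right_mono) auto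
    finally show ?thesis .
  qed
  show "(\<Sum>\<tau>\<in>rooted_all H n e. coef H n \<beta> \<tau> *
      (real (card (rest H e \<tau>)) * a ^ (card (rest H e \<tau>) - 1))) \<le> 2 * dPhi H \<beta> a"
  proof -
    have "(\<Sum>\<tau>\<in>rooted_all H n e. coef H n \<beta> \<tau> *
      (real (card (rest H e \<tau>)) * a ^ (card (rest H e \<tau>) - 1))) =
      (\<Sum>i\<in>UNIV. \<beta> $ i * (?\<kappa> i * (real (num_edges (H i) - 1) * a ^ (num_edges (H i) - 1 - 1))))"
      using sum_rooted_card[where H = H and n = n and e = e and \<beta> = \<beta> and g = "\<lambda>k. real k * a ^ (k - 1)", OF simple] by (simp add: mult.assoc)
    \<comment> \<open>The normalised count never exceeds twice the edge number, and its coefficient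
      is nonnegative unless the term vanishes; hence no error term.\<close>
    also have "\<dots> \<le> (\<Sum>i\<in>UNIV. \<beta> $ i * (2 * real (num_edges (H i)) *
        (real (num_edges (H i) - 1) * a ^ (num_edges (H i) - 1 - 1))))"
      using \<kappa> a by (intro sum_mono beta_mult_mono mult_right_mono) auto
    also have "\<dots> = 2 * dPhi H \<beta> a" by (simp add: dPhi_def sum_distrib_left mult_ac)
    finally show ?thesis .
  qed
next
  show "2 * dPhi H \<beta> a \<le> Kconst H b" if "0 \<le> a" "a \<le> 1" for a by (rule dPhi_le[OF that])
qed (use n Kconst_ge_1 in auto)

end

end

section \<open>Transfer from random graphs to random sets of pairs\<close>

lemma graphs_on_eq: "graphs_on n = SGraph {1..n} ` Pow (pairs n)"
proof (intro equalityI subsetI)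
  fix G assume "G \<in> graphs_on n"
  then have "G = SGraph {1..n} (edges G)" "edges G \<in> Pow (pairs n)"
    by (auto simp: graphs_on_def simple_graph_def pairs_def intro: sgraph.expand)
  then show "G \<in> SGraph {1..n} ` Pow (pairs n)" by (rule image_eqI)
next
  fix G assume "G \<in> SGraph {1..n} ` Pow (pairs n)"
  then obtain x where "G = SGraph {1..n} x" "x \<subseteq> pairs n" by blast
  then show "G \<in> graphs_on n" unfolding graphs_on_def simple_graph_def pairs_def by auto
qed

lemma expectation_num_edges:
  "measure_pmf.expectation (ergm H n \<beta>) (\<lambda>G. real (num_edges G)) =
    (\<Sum>e\<in>pairs n. gibbs.mean (pairs n) (energy H n \<beta>) (\<lambda>x. of_bool (e \<in> x)))"
proof -
  interpret gibbs "pairs n" "energy H n \<beta>" by unfold_locales (rule finite_pairs)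
  have inj: "inj_on (SGraph {1..n}) (Pow (pairs n))" by (auto simp: inj_on_def)
  have w: "ergm_weight H n \<beta> (SGraph {1..n} x) = exp (energy H n \<beta> x)" for x
    by (simp add: ergm_weight_def energy_def)
  have Z: "ergm_Z H n \<beta> = (\<Sum>x\<in>Pow (pairs n). exp (energy H n \<beta> x))"
    unfolding ergm_Z_def graphs_on_eq sum.reindex[OF inj] o_def w ..
  have "measure_pmf.expectation (ergm H n \<beta>) (\<lambda>G. real (num_edges G)) =
      (\<Sum>G\<in>graphs_on n. real (num_edges G) * pmf (ergm H n \<beta>) G)"
    by (rule integral_measure_pmf_real[OF finite_graphs_on]) (auto simp: set_pmf_iff pmf_ergm split: if_splits)
  also have "\<dots> = (\<Sum>G\<in>graphs_on n. real (num_edges G) * (ergm_weight H n \<beta> G / ergm_Z H n \<beta>))"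
    by (rule sum.cong) (auto simp: pmf_ergm)
  also have "\<dots> = (\<Sum>x\<in>Pow (pairs n). real (card x) * (exp (energy H n \<beta> x) / ergm_Z H n \<beta>))"
    unfolding graphs_on_eq sum.reindex[OF inj] o_def w by (simp add: num_edges_def)
  also have "\<dots> = mean (\<lambda>x. real (card x))"
    by (simp add: mean_def Z sum_divide_distrib mult_ac)
  also have "\<dots> = mean (\<lambda>x. \<Sum>e\<in>pairs n. of_bool (e \<in> x))"
  proof (rule mean_cong)
    fix x assume "x \<subseteq> pairs n"
    then show "real (card x) = (\<Sum>e\<in>pairs n. of_bool (e \<in> x))"
      using finite_pairs[of n] by (simp add: Int_absorb1)
  qed
  finally show ?thesis by (simp add: mean_sum)
qed

section \<open>Local uniformity and compactness\<close>

lemma abs_Phi_diff_le: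
  assumes "0 \<le> a" "a \<le> 1"
  shows "\<bar>2 * ergm_Phi H \<beta> a - 2 * ergm_Phi H \<beta>' a\<bar> \<le>
    norm (\<beta> - \<beta>') * (\<Sum>i\<in>UNIV. 2 * real (num_edges (H i)))"
proof -
  have "2 * ergm_Phi H \<beta> a - 2 * ergm_Phi H \<beta>' a =
    (\<Sum>i\<in>UNIV. (\<beta> - \<beta>') $ i * (2 * real (num_edges (H i)) * a ^ (num_edges (H i) - 1)))"
    by (simp add: ergm_Phi_def sum_distrib_left sum_subtractf[symmetric] algebra_simps)
  also have "\<bar>\<dots>\<bar> \<le> (\<Sum>i\<in>UNIV. norm (\<beta> - \<beta>') * (2 * real (num_edges (H i))))"
  proof (intro order_trans[OF sum_abs] sum_mono)
    fix i
    have "2 * real (num_edges (H i)) * a ^ (num_edges (H i) - 1) \<le> 2 * real (num_edges (H i)) * 1"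
      using assms by (intro mult_left_mono power_le_one) auto
    then show "\<bar>(\<beta> - \<beta>') $ i * (2 * real (num_edges (H i)) * a ^ (num_edges (H i) - 1))\<bar> \<le>
      norm (\<beta> - \<beta>') * (2 * real (num_edges (H i)))"
      unfolding abs_mult[of "(\<beta> - \<beta>') $ i"] using assms component_le_norm_cart[of "\<beta> - \<beta>'" i]
      by (intro mult_mono) auto
  qed
  finally show ?thesis by (simp add: sum_distrib_left)
qed

lemma abs_dPhi_diff_le:
  assumes "0 \<le> a" "a \<le> 1"
  shows "\<bar>2 * dPhi H \<beta> a - 2 * dPhi H \<beta>' a\<bar> \<le>
    norm (\<beta> - \<beta>') * (\<Sum>i\<in>UNIV. 2 * real (num_edges (H i)) * real (num_edges (H i) - 1))"
proof -
  have "2 * dPhi H \<beta> a - 2 * dPhi H \<beta>' a =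
    (\<Sum>i\<in>UNIV. (\<beta> - \<beta>') $ i * (2 * real (num_edges (H i)) * real (num_edges (H i) - 1) *
      a ^ (num_edges (H i) - 1 - 1)))"
    by (simp add: dPhi_def sum_distrib_left sum_subtractf[symmetric] algebra_simps)
  also have "\<bar>\<dots>\<bar> \<le> (\<Sum>i\<in>UNIV. norm (\<beta> - \<beta>') * (2 * real (num_edges (H i)) * real (num_edges (H i) - 1)))"
  proof (intro order_trans[OF sum_abs] sum_mono)
    fix i
    have "2 * real (num_edges (H i)) * real (num_edges (H i) - 1) * a ^ (num_edges (H i) - 1 - 1) \<le>
        2 * real (num_edges (H i)) * real (num_edges (H i) - 1) * 1"
      using assms by (intro mult_left_mono power_le_one) auto
    then show "\<bar>(\<beta> - \<beta>') $ i * (2 * real (num_edges (H i)) * real (num_edges (H i) - 1) *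
        a ^ (num_edges (H i) - 1 - 1))\<bar> \<le>
      norm (\<beta> - \<beta>') * (2 * real (num_edges (H i)) * real (num_edges (H i) - 1))"
      unfolding abs_mult[of "(\<beta> - \<beta>') $ i"] using assms component_le_norm_cart[of "\<beta> - \<beta>'" i]
      by (intro mult_mono) auto
  qed
  finally show ?thesis by (simp add: sum_distrib_left)
qed

lemma ergm_phi_eq: "ergm_phi H \<beta> a = logistic (2 * ergm_Phi H \<beta> a)"
  by (simp add: ergm_phi_def logistic_def)

lemma has_real_derivative_Phi: "(ergm_Phi H \<beta> has_real_derivative dPhi H \<beta> a) (at a)"
  unfolding ergm_Phi_def dPhi_def
  by (auto intro!: derivative_eq_intros sum.cong simp: mult_ac)

lemma deriv_phi:
  "deriv (ergm_phi H \<beta>) a = 2 * dPhi H \<beta> a * (ergm_phi H \<beta> a * (1 - ergm_phi H \<beta> a))"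
proof (rule DERIV_imp_deriv)
  have "((\<lambda>a. logistic (2 * ergm_Phi H \<beta> a)) has_real_derivative
    logistic (2 * ergm_Phi H \<beta> a) * (1 - logistic (2 * ergm_Phi H \<beta> a)) * (2 * dPhi H \<beta> a)) (at a)"
    by (intro has_real_derivative_logistic DERIV_cmult has_real_derivative_Phi)
  then show "(ergm_phi H \<beta> has_real_derivative
      2 * dPhi H \<beta> a * (ergm_phi H \<beta> a * (1 - ergm_phi H \<beta> a))) (at a)"
    by (simp add: ergm_phi_eq[abs_def] mult_ac)
qed

text \<open>The fixed point equation \<open>\<phi>(a) = a\<close> is studied in the coordinate \<open>t = 2 \<Phi>(a)\<close>, in
  which it reads \<open>psi t = t\<close>; the field of an edge is to be compared with \<open>t\<close>.\<close>

definition psi :: "('m::finite \<Rightarrow> 'v sgraph) \<Rightarrow> real ^ 'm \<Rightarrow> real \<Rightarrow> real" where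
  "psi H \<beta> t = 2 * ergm_Phi H \<beta> (logistic t)"

definition psi_fix :: "('m::finite \<Rightarrow> 'v sgraph) \<Rightarrow> real ^ 'm \<Rightarrow> real" where
  "psi_fix H \<beta> = 2 * ergm_Phi H \<beta> (ergm_p H \<beta>)"

lemma abs_psi_diff_le:
  "\<bar>psi H \<beta> t - psi H \<beta>' t\<bar> \<le> norm (\<beta> - \<beta>') * (\<Sum>i\<in>UNIV. 2 * real (num_edges (H i)))"
  unfolding psi_def using logistic_pos[of t] logistic_less_1[of t] by (intro abs_Phi_diff_le) auto

lemma continuous_on_psi: "continuous_on S (psi H \<beta>)"
  unfolding psi_def ergm_Phi_def by (intro continuous_intros)

text \<open>Since logistic is injective with values in (0, 1), a fixed point of \<open>psi\<close>
  anywhere on the line yields one of \<open>ergm_phi\<close> in (0, 1), so uniqueness is global in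
  the coordinate t. The last inequality is the derivative condition.\<close>

lemma subcritical_fixed_point:
  assumes "\<beta> \<in> subcritical H i\<^sub>1"
  shows "0 < ergm_p H \<beta>" "ergm_p H \<beta> < 1" "ergm_phi H \<beta> (ergm_p H \<beta>) = ergm_p H \<beta>"
    "logistic (psi_fix H \<beta>) = ergm_p H \<beta>" "psi H \<beta> t = t \<longleftrightarrow> t = psi_fix H \<beta>"
    "2 * dPhi H \<beta> (ergm_p H \<beta>) * (ergm_p H \<beta> * (1 - ergm_p H \<beta>)) < 1"
proof -
  have ex1: "\<exists>!a. a \<in> {0<..<1} \<and> ergm_phi H \<beta> a = a" and d: "deriv (ergm_phi H \<beta>) (ergm_p H \<beta>) < 1"
    using assms by (auto simp: subcritical_def)
  have p: "ergm_p H \<beta> \<in> {0<..<1} \<and> ergm_phi H \<beta> (ergm_p H \<beta>) = ergm_p H \<beta>"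
    unfolding ergm_p_def by (rule theI'[OF ex1])
  then show p': "0 < ergm_p H \<beta>" "ergm_p H \<beta> < 1" "ergm_phi H \<beta> (ergm_p H \<beta>) = ergm_p H \<beta>" by auto
  show l: "logistic (psi_fix H \<beta>) = ergm_p H \<beta>"
    using p by (simp add: psi_fix_def ergm_phi_eq)
  show "psi H \<beta> t = t \<longleftrightarrow> t = psi_fix H \<beta>"
  proof
    assume "psi H \<beta> t = t"
    then have "logistic t \<in> {0<..<1} \<and> ergm_phi H \<beta> (logistic t) = logistic t"
      by (simp add: psi_def ergm_phi_eq logistic_pos logistic_less_1)
    then have "logistic t = ergm_p H \<beta>" using ex1 p by blast
    then show "t = psi_fix H \<beta>" using l logistic_inj by metis
  next
    assume "t = psi_fix H \<beta>"
    then show "psi H \<beta> t = t" using l by (simp add: psi_def) (simp add: psi_fix_def)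
  qed
  show "2 * dPhi H \<beta> (ergm_p H \<beta>) * (ergm_p H \<beta> * (1 - ergm_p H \<beta>)) < 1"
    using d unfolding deriv_phi p'(3) .
qed

text \<open>The sign s selects the upper or the lower tail. The rate c and the threshold on n are
  common to all parameters in U and all edges.\<close>

definition tail_bound :: "('m::finite \<Rightarrow> 'v sgraph) \<Rightarrow> (real ^ 'm) set \<Rightarrow> real \<Rightarrow> real \<Rightarrow> bool" where
  "tail_bound H U s t \<longleftrightarrow> (\<exists>c>0. \<forall>\<^sub>F n in sequentially. \<forall>\<beta>\<in>U. \<forall>e\<in>pairs n.
     gibbs.mean (pairs n) (energy H n \<beta>)
       (\<lambda>x. of_bool (s * t < s * gibbs.field (energy H n \<beta>) e x)) \<le> exp (- c * real n))"

lemma exp_linear_tendsto_0: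
  assumes "0 < c"
  shows "(\<lambda>n. exp (- c * real n)) \<longlonglongrightarrow> 0" "(\<lambda>n. real n * exp (- c * real n)) \<longlonglongrightarrow> 0"
proof -
  have eq: "exp (- c * real n) = exp (- c) ^ n" for n
    by (simp add: exp_of_nat_mult[symmetric] mult.commute)
  have "norm (exp (- c)) < 1" using assms by simp
  then show "(\<lambda>n. exp (- c * real n)) \<longlonglongrightarrow> 0" "(\<lambda>n. real n * exp (- c * real n)) \<longlonglongrightarrow> 0"
    unfolding eq using LIMSEQ_power_zero powser_times_n_limit_0 by blast+
qed

text \<open>\<open>tail_step\<close> is used with L = l n and r = 1/n, so that L r = l is fixed: the
  influence term depends on l alone, and the amplification \<open>exp (2 * l * n * K)\<close> loses
  against the assumed decay if l is small.\<close>

lemma tail_bound_step: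
  assumes U: "\<And>\<beta>. \<beta> \<in> U \<Longrightarrow> ergm_params H i\<^sub>1 \<beta> b" and s: "s = 1 \<or> s = (-1::real)"
    and g: "0 < g" "\<And>\<beta>. \<beta> \<in> U \<Longrightarrow> s * psi H \<beta> t \<le> s * t' - g"
    and tail: "tail_bound H U s t"
  shows "tail_bound H U s t'"
proof (cases "U = {}")
  case True
  then show ?thesis by (auto simp: tail_bound_def intro!: exI[of _ 1])
next
  case False
  define K where "K = Kconst H b"
  have K: "1 \<le> K" using False ergm_params.Kconst_ge_1[OF U] by (auto simp: K_def)
  obtain c where c: "0 < c" and ev: "\<forall>\<^sub>F n in sequentially. \<forall>\<beta>\<in>U. \<forall>e\<in>pairs n.
     gibbs.mean (pairs n) (energy H n \<beta>)
       (\<lambda>x. of_bool (s * t < s * gibbs.field (energy H n \<beta>) e x)) \<le> exp (- c * real n)"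
    using tail unfolding tail_bound_def by blast
  \<comment> \<open>The first entry keeps half of the decay rate c; the second makes the influence
    term at most g/6.\<close>
  define l where "l = min (c / (4 * K)) (ln (1 + g / (6 * K)) / K)"
  have l: "0 < l" "2 * l * K \<le> c / 2" "K * (exp (l * K) - 1) \<le> g / 6"
  proof -
    have "1 < 1 + g / (6 * K)" using g(1) K by simp
    then have ln: "0 < ln (1 + g / (6 * K))" by (rule ln_gt_zero)
    then show "0 < l" using c K by (simp add: l_def)
    have "l \<le> c / (4 * K)" by (simp add: l_def)
    then show "2 * l * K \<le> c / 2" using K by (simp add: field_simps)
    have "l \<le> ln (1 + g / (6 * K)) / K" by (simp add: l_def)
    then have "l * K \<le> ln (1 + g / (6 * K))" using K by (simp add: field_simps)
    then have "exp (l * K) \<le> exp (ln (1 + g / (6 * K)))" by simp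
    also have "\<dots> = 1 + g / (6 * K)" using g K by (simp add: add_pos_pos)
    finally have "K * (exp (l * K) - 1) \<le> K * (g / (6 * K))" using K by (intro mult_left_mono) auto
    then show "K * (exp (l * K) - 1) \<le> g / 6" using K by simp
  qed
  have "(\<lambda>n. K * (1 / real n)) \<longlonglongrightarrow> K * 0"
    by (intro tendsto_mult tendsto_const lim_1_over_n)
  then have ev1: "\<forall>\<^sub>F n in sequentially. K * (1 / real n) < g / 6"
    using g by (intro order_tendstoD(2)) auto
  have "(\<lambda>n. K * exp (- (c / 2) * real n)) \<longlonglongrightarrow> K * 0"
    using c by (intro tendsto_mult tendsto_const exp_linear_tendsto_0) auto
  then have ev2: "\<forall>\<^sub>F n in sequentially. K * exp (- (c / 2) * real n) < g / 6"
    using g by (intro order_tendstoD(2)) auto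
  show ?thesis
    unfolding tail_bound_def
  proof (intro exI[of _ "l * g / 2"] conjI)
    show "0 < l * g / 2" using l g by simp
    show "\<forall>\<^sub>F n in sequentially. \<forall>\<beta>\<in>U. \<forall>e\<in>pairs n. gibbs.mean (pairs n) (energy H n \<beta>)
       (\<lambda>x. of_bool (s * t' < s * gibbs.field (energy H n \<beta>) e x)) \<le> exp (- (l * g / 2) * real n)"
      using ev ev1 ev2 eventually_ge_at_top[of 2]
    proof (eventually_elim, intro ballI)
      case (elim n)
      fix \<beta> e assume \<beta>: "\<beta> \<in> U" and e: "e \<in> pairs n"
      interpret ergm_params H i\<^sub>1 \<beta> b by (rule U[OF \<beta>])
      interpret mean_field "pairs n" "energy H n \<beta>" "rooted_all H n" "coef H n \<beta>" "rest H"
        "\<lambda>a. 2 * ergm_Phi H \<beta> a" "\<lambda>a. 2 * dPhi H \<beta> a" "Kconst H b" "1 / real n"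
        by (rule mean_field_energy) (use elim in auto)
      have n: "0 < real n" using elim by simp
      have LK: "l * real n * K * (1 / real n) = l * K" using n by simp
      have "prob (\<lambda>x. s * t' < s * field e x) \<le> exp (- (l * real n) * (s * t' -
          (s * psi H \<beta> t + K * (1 / real n) + K * (exp (l * real n * K * (1 / real n)) - 1) +
           K * exp (2 * (l * real n) * K) * exp (- c * real n))))"
        using tail_step[OF e s, of "l * real n" t "exp (- c * real n)" t'] l elim(1) \<beta>
        by (simp only: K_def psi_def) simp
      also have "\<dots> \<le> exp (- (l * g / 2) * real n)"
      proof -
        have "K * exp (2 * (l * real n) * K) * exp (- c * real n) \<le> K * exp (- (c / 2) * real n)"
        proof -
          have "2 * (l * real n) * K + - c * real n \<le> - (c / 2) * real n"
            using mult_right_mono[OF l(2), of "real n"] by (simp add: algebra_simps)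
          then show ?thesis using K by (simp add: mult.assoc flip: exp_add)
        qed
        \<comment> \<open>Three errors of at most g/6 each are subtracted from the gap g.\<close>
        then have "g / 2 \<le> s * t' -
          (s * psi H \<beta> t + K * (1 / real n) + K * (exp (l * real n * K * (1 / real n)) - 1) +
           K * exp (2 * (l * real n) * K) * exp (- c * real n))"
          unfolding LK using elim(2,3) l(3) g(2)[OF \<beta>] by linarith
        then have "(l * real n) * (g / 2) \<le> (l * real n) * (s * t' -
          (s * psi H \<beta> t + K * (1 / real n) + K * (exp (l * real n * K * (1 / real n)) - 1) +
           K * exp (2 * (l * real n) * K) * exp (- c * real n)))"
          using l by (intro mult_left_mono) auto
        then show ?thesis by (simp add: mult_ac)
      qed
      finally show "prob (\<lambda>x. s * t' < s * field e x) \<le> exp (- (l * g / 2) * real n)" .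
    qed
  qed
qed

text \<open>The threshold descends in steps of g from \<open>Kconst H b + 1\<close>, which no field
  exceeds, to u0. Of the gap 2 g one half pays for the step, the other for the margin in
  \<open>tail_bound_step\<close>. The number of steps does not depend on n or \<beta>, so a uniform
  positive rate survives. In the coordinate u = s t both tails descend.\<close>

lemma tail_bound_chain:
  assumes U: "\<And>\<beta>. \<beta> \<in> U \<Longrightarrow> ergm_params H i\<^sub>1 \<beta> b" and s: "s = 1 \<or> s = (-1::real)"
    and g: "0 < g" and u0: "u0 \<le> Kconst H b + 1"
    and gap: "\<And>\<beta> u. \<lbrakk>\<beta> \<in> U; u0 \<le> u; u \<le> Kconst H b + 1\<rbrakk> \<Longrightarrow> s * psi H \<beta> (s * u) \<le> u - 2 * g"
  shows "tail_bound H U s (s * u0)"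
proof -
  have ss: "s * (s * u) = u" for u using s by auto
  define u where "u k = max u0 (Kconst H b + 1 - real k * g)" for k
  have "tail_bound H U s (s * u k)" for k
  proof (induction k)
    case 0
    have "gibbs.mean (pairs n) (energy H n \<beta>)
        (\<lambda>x. of_bool (s * (s * u 0) < s * gibbs.field (energy H n \<beta>) e x)) \<le> exp (- 1 * real n)"
      if "2 \<le> n" "\<beta> \<in> U" "e \<in> pairs n" for n \<beta> e
    proof -
      interpret ergm_params H i\<^sub>1 \<beta> b by (rule U[OF that(2)])
      interpret mean_field "pairs n" "energy H n \<beta>" "rooted_all H n" "coef H n \<beta>" "rest H"
        "\<lambda>a. 2 * ergm_Phi H \<beta> a" "\<lambda>a. 2 * dPhi H \<beta> a" "Kconst H b" "1 / real n"
        by (rule mean_field_energy[OF that(1)])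
      have "prob (\<lambda>x. s * (s * u 0) < s * field e x) = mean (\<lambda>_. 0)"
      proof (rule mean_cong)
        fix x assume "x \<subseteq> pairs n"
        then have "\<bar>field e x\<bar> \<le> Kconst H b" using that(3) by (intro field_bound)
        then have "s * field e x \<le> Kconst H b + 1" using s by auto
        then have "s * field e x \<le> s * (s * u 0)" unfolding ss u_def by simp
        then show "of_bool (s * (s * u 0) < s * field e x) = 0" by simp
      qed
      then show ?thesis by simp
    qed
    then have "\<forall>\<^sub>F n in sequentially. \<forall>\<beta>\<in>U. \<forall>e\<in>pairs n. gibbs.mean (pairs n) (energy H n \<beta>)
        (\<lambda>x. of_bool (s * (s * u 0) < s * gibbs.field (energy H n \<beta>) e x)) \<le> exp (- 1 * real n)"
      by (intro eventually_mono[OF eventually_ge_at_top[of 2]]) blast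
    then show ?case unfolding tail_bound_def by (intro exI[of _ 1]) auto
  next
    case (Suc k)
    show ?case
    proof (rule tail_bound_step[OF U s g _ Suc.IH])
      fix \<beta> assume \<beta>: "\<beta> \<in> U"
      have "s * psi H \<beta> (s * u k) \<le> u k - 2 * g"
        using g u0 by (intro gap \<beta>) (auto simp: u_def)
      moreover have "u k - g \<le> u (Suc k)" using g by (auto simp: u_def algebra_simps)
      ultimately show "s * psi H \<beta> (s * u k) \<le> s * (s * u (Suc k)) - g" unfolding ss by linarith
    qed
  qed
  moreover obtain k :: nat where "Kconst H b + 1 - u0 < real k * g"
    using reals_Archimedean3[OF g] by blast
  then have "u k = u0" by (simp add: u_def)
  ultimately show ?thesis by metis
qed

text \<open>As \<open>psi\<close> is bounded, d is nonnegative at K + 1. A nonpositive value at u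
  would force a zero of d at or above u, hence a second fixed point. So d is positive on a compact
  interval and attains a positive minimum.\<close>

lemma psi_gap:
  assumes \<beta>: "\<beta> \<in> subcritical H i\<^sub>1" and s: "s = 1 \<or> s = (-1::real)" and \<epsilon>: "0 < \<epsilon>"
    and K: "\<And>t. \<bar>psi H \<beta> t\<bar> \<le> K - 1"
  obtains g where "0 < g" "\<And>u. \<lbrakk>s * psi_fix H \<beta> + \<epsilon> \<le> u; u \<le> K + 1\<rbrakk> \<Longrightarrow> s * psi H \<beta> (s * u) \<le> u - g"
proof -
  have ss: "s * (s * u) = u" for u using s by auto
  define d where "d u = u - s * psi H \<beta> (s * u)" for u
  have cont: "continuous_on S d" for S
    unfolding d_def
    by (intro continuous_intros continuous_on_compose2[OF continuous_on_psi[of UNIV]]) auto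
  let ?I = "{s * psi_fix H \<beta> + \<epsilon>..K + 1}"
  have pos: "0 < d u" if u: "u \<in> ?I" for u
  proof (rule ccontr)
    assume "\<not> 0 < d u"
    moreover have "0 \<le> d (K + 1)"
      using K[of "s * (K + 1)"] s by (auto simp: d_def)
    ultimately obtain v where v: "u \<le> v" "v \<le> K + 1" "d v = 0"
      using IVT'[of d u 0 "K + 1"] cont u by auto
    then have "psi H \<beta> (s * v) = s * v" using ss[of "psi H \<beta> (s * v)"] by (simp add: d_def)
    then have "s * v = psi_fix H \<beta>" using subcritical_fixed_point(5)[OF \<beta>] by blast
    then have "v = s * psi_fix H \<beta>" using ss[of v] by simp
    then show False using v(1) u \<epsilon> by simp
  qed
  show thesis
  proof (cases "?I = {}")
    case True
    then show thesis using that[of 1] by auto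
  next
    case False
    then obtain u0 where u0: "u0 \<in> ?I" "\<And>u. u \<in> ?I \<Longrightarrow> d u0 \<le> d u"
      using continuous_attains_inf[OF compact_Icc False cont] by blast
    show thesis
    proof (rule that[OF pos[OF u0(1)]])
      fix u assume "s * psi_fix H \<beta> + \<epsilon> \<le> u" "u \<le> K + 1"
      then show "s * psi H \<beta> (s * u) \<le> u - d u0" using u0(2)[of u] by (simp add: d_def)
    qed
  qed
qed

section \<open>Edge density and the bound near one parameter\<close>

definition edge_density :: "('m::finite \<Rightarrow> 'v sgraph) \<Rightarrow> nat \<Rightarrow> real ^ 'm \<Rightarrow> real" where
  "edge_density H n \<beta> =
     measure_pmf.expectation (ergm H n \<beta>) (\<lambda>G. real (num_edges G)) / (real n * (real n - 1) / 2)"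

lemma card_pairs_real: "real (card (pairs n)) = real n * (real n - 1) / 2"
proof (cases n)
  case (Suc m)
  have "even (n * (n - 1))" by (simp add: Suc)
  then show ?thesis unfolding card_pairs choose_two by (simp add: real_of_nat_div Suc algebra_simps)
qed (simp add: card_pairs)

text \<open>The edge density is the average of the edge probabilities, so a bound uniform in e
  carries over.\<close>

lemma abs_edge_density_diff_le:
  assumes "2 \<le> n"
    and "\<And>e. e \<in> pairs n \<Longrightarrow>
      \<bar>gibbs.mean (pairs n) (energy H n \<beta>) (\<lambda>x. of_bool (e \<in> x)) - p\<bar> \<le> a"
  shows "\<bar>p - edge_density H n \<beta>\<bar> \<le> a"
proof -
  let ?N = "real (card (pairs n))"
  have N: "0 < ?N" using assms(1) by (simp add: card_pairs)
  have "edge_density H n \<beta> - p =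
      (\<Sum>e\<in>pairs n. gibbs.mean (pairs n) (energy H n \<beta>) (\<lambda>x. of_bool (e \<in> x)) - p) / ?N"
    using N unfolding edge_density_def expectation_num_edges card_pairs_real[symmetric]
    by (simp add: sum_subtractf field_simps)
  also have "\<bar>\<dots>\<bar> \<le> (\<Sum>e\<in>pairs n. a) / ?N"
  proof -
    have "\<bar>\<Sum>e\<in>pairs n. gibbs.mean (pairs n) (energy H n \<beta>) (\<lambda>x. of_bool (e \<in> x)) - p\<bar> \<le> (\<Sum>e\<in>pairs n. a)"
      using assms(2) by (intro order_trans[OF sum_abs] sum_mono)
    then show ?thesis using N by (simp only: abs_divide abs_of_pos divide_right_mono less_imp_le)
  qed
  also have "\<dots> = a" using N by simp
  finally show ?thesis by linarith
qed

lemma abs_edge_density_diff_le_1: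
  assumes "2 \<le> n" "0 \<le> p" "p \<le> 1"
  shows "\<bar>p - edge_density H n \<beta>\<bar> \<le> 1"
proof (rule abs_edge_density_diff_le[OF assms(1)])
  fix e assume "e \<in> pairs n"
  interpret gibbs "pairs n" "energy H n \<beta>" by unfold_locales (rule finite_pairs)
  have "mean (\<lambda>x. of_bool (e \<in> x)) \<le> mean (\<lambda>_. 1)" by (rule mean_mono) simp
  moreover have "0 \<le> mean (\<lambda>x. of_bool (e \<in> x))" by (rule mean_nonneg) simp
  ultimately show "\<bar>mean (\<lambda>x. of_bool (e \<in> x)) - p\<bar> \<le> 1" using assms by simp
qed

text \<open>The tails are confined around t0, the fixed point for \<open>\<beta>0\<close>, whereas
  the expansion must be centred at the fixed point for the actual parameter. The two differ by less
  than \<epsilon>, so the expansion is used with radius 2 \<epsilon>.\<close>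

lemma local_uniform_bound:
  assumes simple: "\<And>i. simple_graph (H i)" and single: "is_single_edge (H i\<^sub>1)"
    and \<beta>0: "\<beta>0 \<in> subcritical H i\<^sub>1"
  shows "\<exists>\<rho> C. 0 < \<rho> \<and> (\<forall>\<beta> n. \<beta> \<in> subcritical H i\<^sub>1 \<longrightarrow> \<beta> \<in> ball \<beta>0 \<rho> \<longrightarrow> 2 \<le> n \<longrightarrow>
    \<bar>ergm_p H \<beta> - edge_density H n \<beta>\<bar> \<le> C / real n)"
proof -
  define b where "b = norm \<beta>0 + 1"
  define K where "K = Kconst H b"
  have params: "ergm_params H i\<^sub>1 \<beta> b" if "\<beta> \<in> subcritical H i\<^sub>1" "dist \<beta>0 \<beta> \<le> 1" for \<beta>
  proof
    show "\<bar>\<beta> $ i\<bar> \<le> b" for i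
      using component_le_norm_cart[of \<beta> i] norm_triangle_ineq2[of \<beta> \<beta>0] that(2)
      by (simp add: b_def dist_norm norm_minus_commute)
    show "i \<noteq> i\<^sub>1 \<Longrightarrow> 0 \<le> \<beta> $ i" for i using that(1) by (auto simp: subcritical_def less_imp_le)
  qed (fact simple single)+
  have psi_le: "\<bar>psi H \<beta> t\<bar> \<le> K - 1" if "\<beta> \<in> subcritical H i\<^sub>1" "dist \<beta>0 \<beta> \<le> 1" for \<beta> t
    unfolding psi_def K_def using logistic_pos[of t] logistic_less_1[of t]
    by (intro ergm_params.Phi_le[OF params[OF that]]) auto
  have K: "1 \<le> K" unfolding K_def using ergm_params.Kconst_ge_1[OF params[OF \<beta>0]] by simp
  define t0 where "t0 = psi_fix H \<beta>0"
  define \<theta> where "\<theta> \<beta> t = 2 * dPhi H \<beta> (logistic t) * (logistic t * (1 - logistic t))" for \<beta> t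
  \<comment> \<open>The distance to 1 is split in three: one part is lost when t0 gives way to the
    fixed point for \<beta>, one when the coefficients change, and one remains as the contraction
    gap.\<close>
  define \<delta> where "\<delta> = (1 - \<theta> \<beta>0 t0) / 3"
  have \<delta>: "0 < \<delta>"
    using subcritical_fixed_point(4,6)[OF \<beta>0] by (simp add: \<delta>_def \<theta>_def t0_def)
  have "continuous_on UNIV (\<theta> \<beta>0)" unfolding \<theta>_def dPhi_def by (intro continuous_intros)
  then have "isCont (\<theta> \<beta>0) t0" by (simp add: continuous_on_eq_continuous_at)
  then obtain \<epsilon>1 where \<epsilon>1: "0 < \<epsilon>1" "\<And>t. \<bar>t - t0\<bar> < \<epsilon>1 \<Longrightarrow> \<bar>\<theta> \<beta>0 t - \<theta> \<beta>0 t0\<bar> < \<delta>"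
    using \<delta> unfolding continuous_at_eps_delta dist_real_def by blast
  \<comment> \<open>The factor 8 instead of 4 allows for the radius 2 \<epsilon>; the entry 1 keeps
    the thresholds below K + 1.\<close>
  define \<epsilon> where "\<epsilon> = min 1 (min \<epsilon>1 (\<delta> / (8 * K)))"
  have \<epsilon>: "0 < \<epsilon>" "\<epsilon> \<le> \<epsilon>1" "4 * K * (2 * \<epsilon>) \<le> \<delta>" "\<epsilon> \<le> 1"
  proof -
    show "0 < \<epsilon>" "\<epsilon> \<le> \<epsilon>1" "\<epsilon> \<le> 1" using \<epsilon>1 \<delta> K by (auto simp: \<epsilon>_def)
    have "\<epsilon> \<le> \<delta> / (8 * K)" by (simp add: \<epsilon>_def)
    then show "4 * K * (2 * \<epsilon>) \<le> \<delta>" using K by (simp add: field_simps)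
  qed
  obtain g1 where g1: "0 < g1" "\<And>u. \<lbrakk>1 * t0 + \<epsilon> \<le> u; u \<le> K + 1\<rbrakk> \<Longrightarrow> 1 * psi H \<beta>0 (1 * u) \<le> u - g1"
    unfolding t0_def by (rule psi_gap[OF \<beta>0 _ \<epsilon>(1) psi_le[OF \<beta>0], of 1]) auto
  obtain g2 where g2: "0 < g2" "\<And>u. \<lbrakk>- 1 * t0 + \<epsilon> \<le> u; u \<le> K + 1\<rbrakk> \<Longrightarrow> - 1 * psi H \<beta>0 (- 1 * u) \<le> u - g2"
    unfolding t0_def by (rule psi_gap[OF \<beta>0 _ \<epsilon>(1) psi_le[OF \<beta>0], of "- 1"]) auto
  \<comment> \<open>One third of the gap at \<open>\<beta>0\<close> is lost in moving to \<beta>,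
    which leaves the 2 g required by \<open>tail_bound_chain\<close>.\<close>
  define g where "g = min g1 g2 / 3"
  have g: "0 < g" using g1 g2 by (simp add: g_def)
  \<comment> \<open>A common Lipschitz constant in \<beta> for 2 \<Phi> and its derivative on
    [0, 1]; the summand 1 keeps it positive.\<close>
  define L where "L = 1 + (\<Sum>i\<in>UNIV. 2 * real (num_edges (H i))) +
    (\<Sum>i\<in>UNIV. 2 * real (num_edges (H i)) * real (num_edges (H i) - 1))"
  have sums: "0 \<le> (\<Sum>i\<in>UNIV. 2 * real (num_edges (H i)))"
    "0 \<le> (\<Sum>i\<in>UNIV. 2 * real (num_edges (H i)) * real (num_edges (H i) - 1))"
    by (auto intro!: sum_nonneg)
  then have L: "1 \<le> L" by (simp add: L_def)
  define \<rho> where "\<rho> = min 1 (min g \<delta> / L)"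
  have \<rho>: "0 < \<rho>" "\<rho> \<le> 1" using g \<delta> L by (auto simp: \<rho>_def)
  have "\<rho> \<le> min g \<delta> / L" by (simp add: \<rho>_def)
  then have \<rho>L: "\<rho> * L \<le> min g \<delta>" using L by (simp add: field_simps)
  define U where "U = subcritical H i\<^sub>1 \<inter> ball \<beta>0 \<rho>"
  have U: "\<beta> \<in> subcritical H i\<^sub>1" "dist \<beta>0 \<beta> \<le> 1" "norm (\<beta> - \<beta>0) \<le> \<rho>" if "\<beta> \<in> U" for \<beta>
    using that \<rho> by (auto simp: U_def dist_norm norm_minus_commute)
  have near: "norm (\<beta> - \<beta>0) * S \<le> min g \<delta>" if "\<beta> \<in> U" "0 \<le> S" "S \<le> L" for \<beta> S
  proof -
    have "norm (\<beta> - \<beta>0) * S \<le> \<rho> * L" using U(3)[OF that(1)] that \<rho> by (intro mult_mono) auto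
    then show ?thesis using \<rho>L by linarith
  qed
  have gap: "s * psi H \<beta> (s * u) \<le> u - 2 * g"
    if s: "s = 1 \<or> s = -1" and \<beta>: "\<beta> \<in> U" and u: "s * t0 + \<epsilon> \<le> u" "u \<le> K + 1" for s \<beta> u
  proof -
    have "s * psi H \<beta>0 (s * u) \<le> u - 3 * g"
      using s g1(2)[of u] g2(2)[of u] u by (auto simp: g_def)
    moreover have "\<bar>psi H \<beta> (s * u) - psi H \<beta>0 (s * u)\<bar> \<le> g"
      using abs_psi_diff_le[of H \<beta> "s * u" \<beta>0] sums
        near[OF \<beta>, of "\<Sum>i\<in>UNIV. 2 * real (num_edges (H i))"] by (simp add: L_def)
    ultimately show ?thesis using s by auto
  qed
  \<comment> \<open>A fixed point at distance \<epsilon> or more from t0 would contradict the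
    gap.\<close>
  have fix_near: "\<bar>psi_fix H \<beta> - t0\<bar> < \<epsilon>" if \<beta>: "\<beta> \<in> U" for \<beta>
  proof -
    have fp: "psi H \<beta> (psi_fix H \<beta>) = psi_fix H \<beta>"
      using subcritical_fixed_point(5)[OF U(1)[OF \<beta>]] by blast
    have le: "\<bar>psi_fix H \<beta>\<bar> \<le> K + 1"
      using psi_le[OF U(1,2)[OF \<beta>], of "psi_fix H \<beta>"] fp by linarith
    have "\<not> s * t0 + \<epsilon> \<le> s * psi_fix H \<beta>" if s: "s = 1 \<or> s = -1" for s
    proof
      assume "s * t0 + \<epsilon> \<le> s * psi_fix H \<beta>"
      then have "s * psi H \<beta> (s * (s * psi_fix H \<beta>)) \<le> s * psi_fix H \<beta> - 2 * g"
        using s le by (intro gap \<beta>) auto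
      then show False using s fp g by auto
    qed
    from this[of 1] this[of "- 1"] show ?thesis by auto
  qed
  have t0_le: "\<bar>t0\<bar> \<le> K - 1"
    using psi_le[OF \<beta>0, of t0] subcritical_fixed_point(5)[OF \<beta>0, of t0] by (simp add: t0_def)
  have tail: "tail_bound H U s (s * (s * t0 + \<epsilon>))" if s: "s = 1 \<or> s = -1" for s
  proof (rule tail_bound_chain[OF params s g])
    show "s * t0 + \<epsilon> \<le> Kconst H b + 1" using s t0_le \<epsilon>(4) by (auto simp flip: K_def)
  qed (use s U gap in \<open>auto simp flip: K_def\<close>)
  have tail1: "tail_bound H U 1 (t0 + \<epsilon>)" and tail2: "tail_bound H U (- 1) (t0 - \<epsilon>)"
    using tail[of 1] tail[of "- 1"] by simp_all
  obtain c1 where c1: "0 < c1"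
    and ev1: "\<forall>\<^sub>F n in sequentially. \<forall>\<beta>\<in>U. \<forall>e\<in>pairs n. gibbs.mean (pairs n) (energy H n \<beta>)
       (\<lambda>x. of_bool (1 * (t0 + \<epsilon>) < 1 * gibbs.field (energy H n \<beta>) e x)) \<le> exp (- c1 * real n)"
    using tail1 unfolding tail_bound_def by blast
  obtain c2 where c2: "0 < c2"
    and ev2: "\<forall>\<^sub>F n in sequentially. \<forall>\<beta>\<in>U. \<forall>e\<in>pairs n. gibbs.mean (pairs n) (energy H n \<beta>)
       (\<lambda>x. of_bool (- 1 * (t0 - \<epsilon>) < - 1 * gibbs.field (energy H n \<beta>) e x)) \<le> exp (- c2 * real n)"
    using tail2 unfolding tail_bound_def by blast
  \<comment> \<open>Each tail may contribute 1/(2n), so that the bad event has probability at most r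
    = 1/n.\<close>
  have ev3: "\<forall>\<^sub>F n in sequentially. real n * exp (- c1 * real n) < 1 / 2"
    "\<forall>\<^sub>F n in sequentially. real n * exp (- c2 * real n) < 1 / 2"
    by (rule order_tendstoD(2)[OF exp_linear_tendsto_0(2)[OF c1]], simp)
      (rule order_tendstoD(2)[OF exp_linear_tendsto_0(2)[OF c2]], simp)
  define C0 where "C0 = (88 * K ^ 5 / \<delta> + 3 * K\<^sup>2) / \<delta>"
  have "\<forall>\<^sub>F n in sequentially. \<forall>\<beta>\<in>U. \<bar>ergm_p H \<beta> - edge_density H n \<beta>\<bar> \<le> C0 / real n"
    using ev1 ev2 ev3 eventually_ge_at_top[of 2]
  proof (eventually_elim, intro ballI)
    case (elim n)
    fix \<beta> assume \<beta>: "\<beta> \<in> U"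
    note sub = subcritical_fixed_point[OF U(1)[OF \<beta>]]
    let ?t = "psi_fix H \<beta>" and ?p = "ergm_p H \<beta>"
    interpret ergm_params H i\<^sub>1 \<beta> b by (rule params[OF U(1,2)[OF \<beta>]])
    interpret mean_field "pairs n" "energy H n \<beta>" "rooted_all H n" "coef H n \<beta>" "rest H"
      "\<lambda>a. 2 * ergm_Phi H \<beta> a" "\<lambda>a. 2 * dPhi H \<beta> a" "Kconst H b" "1 / real n"
      by (rule mean_field_energy) (use elim in auto)
    show "\<bar>?p - edge_density H n \<beta>\<bar> \<le> C0 / real n"
    proof (rule abs_edge_density_diff_le)
      fix e assume e: "e \<in> pairs n"
      have "\<bar>mean (\<lambda>x. of_bool (e \<in> x)) - ?p\<bar> \<le>
          (88 * Kconst H b ^ 5 / \<delta> + 3 * (Kconst H b)\<^sup>2) / \<delta> * (1 / real n)"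
      proof (rule mean_mem_approx)
        show "?p = logistic ?t" by (rule sub(4)[symmetric])
        show "?t = 2 * ergm_Phi H \<beta> ?p" by (rule psi_fix_def)
        show "\<bar>?t\<bar> \<le> Kconst H b"
          using psi_le[OF U(1,2)[OF \<beta>], of ?t] sub(5)[of ?t] by (simp add: K_def)
        show "2 * dPhi H \<beta> ?p * (?p * (1 - ?p)) \<le> 1 - \<delta>"
        proof -
          have p01: "0 \<le> ?p" "?p \<le> 1" using sub(1,2) by auto
          have v: "0 \<le> ?p * (1 - ?p)" "?p * (1 - ?p) \<le> 1" using p01 by (auto intro: mult_le_one)
          have "\<bar>2 * dPhi H \<beta> ?p - 2 * dPhi H \<beta>0 ?p\<bar> \<le> \<delta>"
            using abs_dPhi_diff_le[OF p01, of H \<beta> \<beta>0] sums near[OF \<beta>,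
              of "\<Sum>i\<in>UNIV. 2 * real (num_edges (H i)) * real (num_edges (H i) - 1)"]
            by (simp add: L_def)
          then have "\<bar>2 * dPhi H \<beta> ?p - 2 * dPhi H \<beta>0 ?p\<bar> * (?p * (1 - ?p)) \<le> \<delta> * 1"
            using v by (intro mult_mono) auto
          then have "(2 * dPhi H \<beta> ?p - 2 * dPhi H \<beta>0 ?p) * (?p * (1 - ?p)) \<le> \<delta>"
            by (simp add: order_trans[OF mult_right_mono[OF abs_ge_self v(1)]])
          moreover have "2 * dPhi H \<beta>0 ?p * (?p * (1 - ?p)) \<le> 1 - 2 * \<delta>"
          proof -
            have "\<bar>\<theta> \<beta>0 ?t - \<theta> \<beta>0 t0\<bar> < \<delta>" using fix_near[OF \<beta>] \<epsilon>(2) by (intro \<epsilon>1(2)) linarith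
            moreover have "\<theta> \<beta>0 t0 = 1 - 3 * \<delta>" by (simp add: \<delta>_def field_simps)
            ultimately have "\<theta> \<beta>0 ?t \<le> 1 - 2 * \<delta>" by linarith
            then show ?thesis unfolding \<theta>_def sub(4) .
          qed
          ultimately show ?thesis unfolding left_diff_distrib by linarith
        qed
        show "0 < \<delta>" by (rule \<delta>)
        show "0 < 2 * \<epsilon>" "4 * Kconst H b * (2 * \<epsilon>) \<le> \<delta>" using \<epsilon> by (simp_all add: K_def)
        show "prob (\<lambda>x. 2 * \<epsilon> < \<bar>field j x - ?t\<bar>) \<le> 1 / real n" if j: "j \<in> pairs n" for j
        proof -
          \<comment> \<open>A deviation beyond 2 \<epsilon> from a point within \<epsilon> of t0
            puts the field outside [t0 - \<epsilon>, t0 + \<epsilon>].\<close>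
          have "prob (\<lambda>x. 2 * \<epsilon> < \<bar>field j x - ?t\<bar>) \<le>
              mean (\<lambda>x. of_bool (1 * (t0 + \<epsilon>) < 1 * field j x) +
                of_bool (- 1 * (t0 - \<epsilon>) < - 1 * field j x))"
            using fix_near[OF \<beta>] by (intro mean_mono) (auto simp: abs_if split: if_splits)
          also have "\<dots> \<le> exp (- c1 * real n) + exp (- c2 * real n)"
            unfolding mean_add using elim(1,2) \<beta> j by (intro add_mono) blast+
          also have "\<dots> \<le> 1 / real n"
            using elim(3-5) by (simp add: field_simps)
          finally show ?thesis .
        qed
      qed (fact e)
      then show "\<bar>mean (\<lambda>x. of_bool (e \<in> x)) - ?p\<bar> \<le> C0 / real n" by (simp add: C0_def K_def)
    qed (use elim in auto)
  qed
  then obtain n0 where n0: "\<And>n \<beta>. \<lbrakk>n0 \<le> n; \<beta> \<in> U\<rbrakk> \<Longrightarrow>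
      \<bar>ergm_p H \<beta> - edge_density H n \<beta>\<bar> \<le> C0 / real n"
    unfolding eventually_sequentially by blast
  show ?thesis
  \<comment> \<open>The entry n0 covers n < n0, where the difference is at most 1 and hence at most
    n0/n.\<close>
  proof (rule exI[of _ \<rho>], rule exI[of _ "max C0 (real n0)"], intro conjI allI impI)
    fix \<beta> and n :: nat
    assume \<beta>: "\<beta> \<in> subcritical H i\<^sub>1" "\<beta> \<in> ball \<beta>0 \<rho>" and n: "2 \<le> n"
    show "\<bar>ergm_p H \<beta> - edge_density H n \<beta>\<bar> \<le> max C0 (real n0) / real n"
    proof (cases "n0 \<le> n")
      case True
      have "\<bar>ergm_p H \<beta> - edge_density H n \<beta>\<bar> \<le> C0 / real n"
        using \<beta> by (intro n0[OF True]) (simp add: U_def)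
      also have "\<dots> \<le> max C0 (real n0) / real n" by (intro divide_right_mono) auto
      finally show ?thesis .
    next
      case False
      have "\<bar>ergm_p H \<beta> - edge_density H n \<beta>\<bar> \<le> 1"
        using subcritical_fixed_point(1,2)[OF \<beta>(1)] n by (intro abs_edge_density_diff_le_1) auto
      also have "1 \<le> max C0 (real n0) / real n" using False n by (simp add: le_divide_eq)
      finally show ?thesis .
    qed
  qed (fact \<rho>(1))
qed

theorem proposition1p1:
  fixes H :: "'m::finite \<Rightarrow> 'v sgraph" and i\<^sub>1 :: 'm and B :: "(real ^ 'm) set"
  assumes "\<And>i. simple_graph (H i)"
    and "\<And>i. no_isolated_vertices (H i)"
    and "is_single_edge (H i\<^sub>1)"
    and "\<And>i. i \<noteq> i\<^sub>1 \<Longrightarrow> num_edges (H i) \<ge> 2"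
    and "compact B" and "B \<subseteq> subcritical H i\<^sub>1"
  shows "\<exists>C::real. \<forall>\<beta>\<in>B. \<forall>n::nat. n \<ge> 2 \<longrightarrow>
    (let N = real n * (real n - 1) / 2;
         p_tilde = measure_pmf.expectation (ergm H n \<beta>) (\<lambda>G. real (num_edges G)) / N
     in \<bar>ergm_p H \<beta> - p_tilde\<bar> \<le> C / real n)"
proof -
  have "\<exists>\<rho> C. 0 < \<rho> \<and> (\<forall>\<beta> n. \<beta> \<in> subcritical H i\<^sub>1 \<longrightarrow> \<beta> \<in> ball \<beta>0 \<rho> \<longrightarrow> 2 \<le> n \<longrightarrow>
      \<bar>ergm_p H \<beta> - edge_density H n \<beta>\<bar> \<le> C / real n)" if "\<beta>0 \<in> B" for \<beta>0
    using assms(1,3,6) that by (intro local_uniform_bound) auto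
  then obtain \<rho> C where \<rho>: "\<And>\<beta>0. \<beta>0 \<in> B \<Longrightarrow> 0 < \<rho> \<beta>0"
    and C: "\<And>\<beta>0 \<beta> n. \<lbrakk>\<beta>0 \<in> B; \<beta> \<in> subcritical H i\<^sub>1; \<beta> \<in> ball \<beta>0 (\<rho> \<beta>0); 2 \<le> n\<rbrakk> \<Longrightarrow>
      \<bar>ergm_p H \<beta> - edge_density H n \<beta>\<bar> \<le> C \<beta>0 / real n"
    by metis
  obtain D where D: "D \<subseteq> B" "finite D" "B \<subseteq> (\<Union>\<beta>0\<in>D. ball \<beta>0 (\<rho> \<beta>0))"
  proof (rule compactE_image[OF assms(5), of B "\<lambda>\<beta>0. ball \<beta>0 (\<rho> \<beta>0)"])
    show "B \<subseteq> (\<Union>\<beta>0\<in>B. ball \<beta>0 (\<rho> \<beta>0))" using \<rho> by auto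
  qed auto
  \<comment> \<open>The absolute values let the sum dominate every single constant, whatever the
    signs.\<close>
  have "\<bar>ergm_p H \<beta> - edge_density H n \<beta>\<bar> \<le> (\<Sum>\<beta>0\<in>D. \<bar>C \<beta>0\<bar>) / real n"
    if \<beta>: "\<beta> \<in> B" and n: "2 \<le> n" for \<beta> n
  proof -
    obtain \<beta>0 where \<beta>0: "\<beta>0 \<in> D" "\<beta> \<in> ball \<beta>0 (\<rho> \<beta>0)" using D \<beta> by blast
    have "\<bar>ergm_p H \<beta> - edge_density H n \<beta>\<bar> \<le> C \<beta>0 / real n"
      using \<beta>0 D \<beta> n assms(6) by (intro C) auto
    also have "\<dots> \<le> (\<Sum>\<beta>0\<in>D. \<bar>C \<beta>0\<bar>) / real n"
      using member_le_sum[OF \<beta>0(1), of "\<lambda>\<beta>0. \<bar>C \<beta>0\<bar>"] D(2)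
      by (intro divide_right_mono) auto
    finally show ?thesis .
  qed
  then show ?thesis unfolding edge_density_def Let_def by blast
qed

end
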